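(* Assume that the quadruple $(\alpha,\beta,\gamma,\delta)$ is admissible and nondegenerate. Then the probability measures $\mathcal{M}_N^{\alpha,\beta,\gamma,\delta}$ on $\mathbb{G}_N$, $N=1,2,\dots$, given by $$\mathcal{M}_N^{\alpha,\beta,\gamma,\delta}(X)=\frac1{\mathcal{Z}_N(\alpha,\beta,\gamma,\delta)}\prod_{i=1}^N w_N^{\alpha,\beta,\gamma,\delta}(x_i)\prod_{1\le i<j\le N}(x_j-x_i)^2,\qquad X=(x_1<\dots<x_N)\in\mathbb{G}_N,$$ form a coherent system on the extended Gelfand–Tsetlin graph, that is, $\mathcal{M}^{\alpha,\beta,\gamma,\delta}_{N+1}\Lambda^{N+1}_N=\mathcal{M}^{\alpha,\beta,\gamma,\delta}_N$ for all $N=1,2,\dots$.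
   Context: Fix $q\in(0,1)$, $\zeta_-<0$, $\zeta_+>0$, and let $\mathfrak{L}=\{\zeta_-q^m:m\in\mathbb{Z}\}\sqcup\{\zeta_+q^n:n\in\mathbb{Z}\}\subset\mathbb{R}\setminus\{0\}$. $\mathbb{G}_N$ ($N\ge1$) is the set of $N$-element subsets $X=(x_1<\dots<x_N)$ of $\mathfrak{L}$. Interlacing. For $a<b$ in $\mathfrak{L}$ put $I(a,b)=[a,b)\cap\mathfrak{L}$ if $a<b<0$; $I(a,b)=[a,b]\cap\mathfrak{L}$ if $a<0<b$; $I(a,b)=(a,b]\cap\mathfrak{L}$ if $0<a<b$. For $X\in\mathbb{G}_{N+1}$, $Y\in\mathbb{G}_N$ write $Y\prec X$ if $y_i\in I(x_i,x_{i+1})$ for $i=1,\dots,N$. $q$-links. $\Lambda^{N+1}_N$ is the stochastic matrix of format $\mathbb{G}_{N+1}\times\mathbb{G}_N$ with $$\Lambda^{N+1}_N(X,Y)=\prod_{i=1}^N|y_i|\cdot(1-q)\cdots(1-q^N)\cdot\frac{\prod_{1\le i<j\le N}(y_j-y_i)}{\prod_{1\le i<j\le N+1}(x_j-x_i)}$$ if $Y\prec X$, and $0$ otherwise. Measures on $\mathbb{G}_{N+1}$ are regarded as row vectors. Weights. $(a;q)_\infty=\prod_{m\ge0}(1-aq^m)$ and $(a,b;q)_\infty=(a;q)_\infty(b;q)_\infty$. For $x\in\mathfrak{L}$, $$w_N^{\alpha,\beta,\gamma,\delta}(x)=|x|\frac{(\alpha x,\beta x;q)_\infty}{(\gamma q^{1-N}x,\delta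 q^{1-N}x;q)_\infty},\qquad \mathcal{Z}_N(\alpha,\beta,\gamma,\delta)=\sum_{X\in\mathbb{G}_N}\prod_{i=1}^Nw_N^{\alpha,\beta,\gamma,\delta}(x_i)\prod_{1\le i<j\le N}(x_j-x_i)^2 .$$ Admissibility. A quadruple $(\alpha,\beta,\gamma,\delta)$ of nonzero complex numbers is admissible and nondegenerate if each of the pairs $(a,b)=(\alpha,\beta)$ and $(a,b)=(\gamma,\delta)$ satisfies one of: (i) $a,b$ are nonreal and complex conjugate; (ii) $a,b$ are real and $a^{-1},b^{-1}$ lie in one open interval between two neighboring points of $\mathfrak{L}$; and, moreover, $\gamma\delta q>\alpha\beta$. Under this condition $w_N^{\alpha,\beta,\gamma,\delta}>0$ on $\mathfrak{L}$ and $\mathcal{Z}_N(\alpha,\beta,\gamma,\delta)<\infty$ for all $N$. *)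

theory Defs
  imports "HOL-Analysis.Analysis"
begin

definition lattice :: "real \<Rightarrow> real \<Rightarrow> real \<Rightarrow> real set" where
  "lattice q zm zp = range (\<lambda>m::int. zm * q powi m) \<union> range (\<lambda>n::int. zp * q powi n)"

definition configs :: "real \<Rightarrow> real \<Rightarrow> real \<Rightarrow> nat \<Rightarrow> real set set" where
  "configs q zm zp N = {X. X \<subseteq> lattice q zm zp \<and> finite X \<and> card X = N}"

text \<open>Points of a configuration in increasing order, numbered from 0.\<close>

definition point :: "real set \<Rightarrow> nat \<Rightarrow> real" where
  "point X i = sorted_list_of_set X ! i"

definition vandermonde :: "real set \<Rightarrow> real" where
  "vandermonde X = (\<Prod>j<card X. \<Prod>i<j. point X j - point X i)"

text \<open>Only used for \<open>a < b\<close> in the lattice, so in the second branch \<open>a < 0 < b\<close>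
  and in the third \<open>0 < a < b\<close>.\<close>

definition interlacing_interval :: "real \<Rightarrow> real \<Rightarrow> real \<Rightarrow> real \<Rightarrow> real \<Rightarrow> real set" where
  "interlacing_interval q zm zp a b =
     (if b < 0 then {a..<b} else if a < 0 then {a..b} else {a<..b}) \<inter> lattice q zm zp"

definition interlaces :: "real \<Rightarrow> real \<Rightarrow> real \<Rightarrow> nat \<Rightarrow> real set \<Rightarrow> real set \<Rightarrow> bool" where
  "interlaces q zm zp N Y X \<longleftrightarrow>
     (\<forall>i<N. point Y i \<in> interlacing_interval q zm zp (point X i) (point X (Suc i)))"

definition qlink :: "real \<Rightarrow> real \<Rightarrow> real \<Rightarrow> nat \<Rightarrow> real set \<Rightarrow> real set \<Rightarrow> real" where
  "qlink q zm zp N X Y =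
     (if interlaces q zm zp N Y X
      then (\<Prod>y\<in>Y. \<bar>y\<bar>) * (\<Prod>k=1..N. 1 - q ^ k) * (vandermonde Y / vandermonde X)
      else 0)"

definition prob_mass_on :: "'a set \<Rightarrow> ('a \<Rightarrow> real) \<Rightarrow> bool" where
  "prob_mass_on A \<mu> \<longleftrightarrow> (\<forall>x\<in>A. 0 \<le> \<mu> x) \<and> (\<mu> has_sum 1) A"

definition coherent_system ::
    "real \<Rightarrow> real \<Rightarrow> real \<Rightarrow> (nat \<Rightarrow> real set \<Rightarrow> real) \<Rightarrow> bool" where
  "coherent_system q zm zp \<mu> \<longleftrightarrow>
     (\<forall>N\<ge>1. prob_mass_on (configs q zm zp N) (\<mu> N)) \<and>
     (\<forall>N\<ge>1. \<forall>Y\<in>configs q zm zp N.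
        ((\<lambda>X. \<mu> (Suc N) X * qlink q zm zp N X Y) has_sum \<mu> N Y) (configs q zm zp (Suc N)))"

definition qpoch_inf :: "complex \<Rightarrow> real \<Rightarrow> complex" where
  "qpoch_inf a q = prodinf (\<lambda>m. 1 - a * of_real q ^ m)"

text \<open>The parameters are complex, so the weights, the partition function and the normalized
  masses are defined as complex numbers; for admissible parameters they are real.\<close>

definition weight ::
    "real \<Rightarrow> nat \<Rightarrow> complex \<Rightarrow> complex \<Rightarrow> complex \<Rightarrow> complex \<Rightarrow> real \<Rightarrow> complex" where
  "weight q N \<alpha> \<beta> \<gamma> \<delta> x =
     of_real \<bar>x\<bar> * (qpoch_inf (\<alpha> * of_real x) q * qpoch_inf (\<beta> * of_real x) q)
       / (qpoch_inf (\<gamma> * of_real (q powi (1 - int N)) * of_real x) q *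
          qpoch_inf (\<delta> * of_real (q powi (1 - int N)) * of_real x) q)"

definition unnormalized_mass ::
    "real \<Rightarrow> complex \<Rightarrow> complex \<Rightarrow> complex \<Rightarrow> complex \<Rightarrow> nat \<Rightarrow> real set \<Rightarrow> complex" where
  "unnormalized_mass q \<alpha> \<beta> \<gamma> \<delta> N X =
     (\<Prod>x\<in>X. weight q N \<alpha> \<beta> \<gamma> \<delta> x) * of_real (vandermonde X ^ 2)"

definition partition_function ::
    "real \<Rightarrow> real \<Rightarrow> real \<Rightarrow> complex \<Rightarrow> complex \<Rightarrow> complex \<Rightarrow> complex \<Rightarrow> nat \<Rightarrow> complex" where
  "partition_function q zm zp \<alpha> \<beta> \<gamma> \<delta> N =
     (\<Sum>\<^sub>\<infinity>X\<in>configs q zm zp N. unnormalized_mass q \<alpha> \<beta> \<gamma> \<delta> N X)"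

definition mass ::
    "real \<Rightarrow> real \<Rightarrow> real \<Rightarrow> complex \<Rightarrow> complex \<Rightarrow> complex \<Rightarrow> complex \<Rightarrow> nat \<Rightarrow> real set \<Rightarrow> complex" where
  "mass q zm zp \<alpha> \<beta> \<gamma> \<delta> N X =
     unnormalized_mass q \<alpha> \<beta> \<gamma> \<delta> N X / partition_function q zm zp \<alpha> \<beta> \<gamma> \<delta> N"

definition admissible_pair :: "real \<Rightarrow> real \<Rightarrow> real \<Rightarrow> complex \<Rightarrow> complex \<Rightarrow> bool" where
  "admissible_pair q zm zp a b \<longleftrightarrow>
     (a \<notin> \<real> \<and> b = cnj a) \<or>
     (a \<in> \<real> \<and> b \<in> \<real> \<and>
      (\<exists>u\<in>lattice q zm zp. \<exists>v\<in>lattice q zm zp.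
         u < v \<and> {u<..<v} \<inter> lattice q zm zp = {} \<and>
         Re (inverse a) \<in> {u<..<v} \<and> Re (inverse b) \<in> {u<..<v}))"

text \<open>For admissible pairs both products in the last condition are real, so taking real parts
  only changes the type.\<close>

definition admissible_nondegenerate ::
    "real \<Rightarrow> real \<Rightarrow> real \<Rightarrow> complex \<Rightarrow> complex \<Rightarrow> complex \<Rightarrow> complex \<Rightarrow> bool" where
  "admissible_nondegenerate q zm zp \<alpha> \<beta> \<gamma> \<delta> \<longleftrightarrow>
     \<alpha> \<noteq> 0 \<and> \<beta> \<noteq> 0 \<and> \<gamma> \<noteq> 0 \<and> \<delta> \<noteq> 0 \<and>
     admissible_pair q zm zp \<alpha> \<beta> \<and> admissible_pair q zm zp \<gamma> \<delta> \<and>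
     Re (\<gamma> * \<delta>) * q > Re (\<alpha> * \<beta>)"

end

theory Submission
  imports Defs "Jordan_Normal_Form.Determinant"
begin

text \<open>
  Write \<open>w\<^sub>N\<close> for the weights and \<open>V\<close> for the Vandermonde product. One of the two factors \<open>V(X)\<close>
  in the mass of \<open>X\<close> cancels against the denominator of the link, so that coherence reduces to the
  identity \<open>\<Sum>\<^bsub>X \<succ> Y\<^esub> V(X) \<Prod> w\<^bsub>N+1\<^esub>(x) = c V(Y) \<Prod> w\<^sub>N(y) / \<bar>y\<bar>\<close>, with a constant \<open>c\<close>
  that may depend on \<open>N\<close> but not on \<open>Y\<close>.

  Interlacing decouples the points of \<open>X\<close>: for fixed \<open>Y\<close>, each of them ranges independently over a
  cell of the lattice between two consecutive points of \<open>Y\<close>. If \<open>V(X)\<close> is written as a determinant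
  of values of polynomials \<open>p\<^sub>j\<close> of degree \<open>j\<close>, the left side therefore becomes the determinant of
  the one-dimensional sums of \<open>w\<^bsub>N+1\<^esub> p\<^sub>j\<close> over the cells (\<open>chamber_sum\<close>). The choice of
  \<open>p\<^sub>j\<close> is free up to leading coefficients. The ratio \<open>w\<^sub>N(x) / \<bar>x\<bar>\<close> satisfies a first order
  \<open>q\<close>-difference equation, which yields \<open>p\<^bsub>k+1\<^esub>\<close> such that \<open>w\<^bsub>N+1\<^esub> p\<^bsub>k+1\<^esub>\<close> is, up to the
  sign of \<open>x\<close>, the \<open>q\<close>-difference of \<open>w\<^sub>N(x) x\<^sup>k / \<bar>x\<bar>\<close> (\<open>telescoping\<close>); take \<open>p\<^sub>0 = 1\<close>. After
  successive summation of rows, row \<open>i\<close> holds the sums over all lattice points up to \<open>y\<^sub>i\<close>. In all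
  columns but the first these are boundary values at \<open>y\<^sub>i\<close> (\<open>has_sum_down\<close>). In the last row,
  which holds the sums over the whole lattice, only the first entry survives because the boundary
  terms vanish at infinity. Expanding along that row leaves \<open>V(Y) \<Prod> w\<^sub>N(y) / \<bar>y\<bar>\<close> up to a
  constant (\<open>interlacing_sum\<close>). The inequality \<open>\<gamma>\<delta>q > \<alpha>\<beta>\<close> gives the convergence of the partition functions, the vanishing at
  infinity, and the nonvanishing of the leading coefficients of the \<open>p\<^sub>j\<close>.

  The constant is identified indirectly. The links are stochastic, by the same determinant computation
  with Jackson integrals of monomials (\<open>qlink_stochastic\<close>). Summing the identity over \<open>Y\<close> therefore
  shows that \<open>c\<close>, times the factor \<open>(1 - q) \<dots> (1 - q\<^sup>N)\<close> of the link, is the quotient of two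
  consecutive partition functions (\<open>real_partition_Suc\<close>).

  The complex parameters enter only through \<open>\<alpha> + \<beta>\<close>, \<open>\<alpha>\<beta>\<close>, \<open>\<gamma> + \<delta>\<close> and \<open>\<gamma>\<delta>\<close>, which are real, so
  the whole argument takes place over the reals; \<open>mass_eq\<close> makes the translation.
\<close>

section \<open>Determinants and the Vandermonde product\<close>

text \<open>
  Matrices are handled through their entry functions, indexed from 0, because all entries below
  are given by formulas in the row and the column.
\<close>

abbreviation detf :: "nat \<Rightarrow> (nat \<Rightarrow> nat \<Rightarrow> real) \<Rightarrow> real" where
  "detf n a \<equiv> Determinant.det (Matrix.mat n n (\<lambda>(i, j). a i j))"

lemma detf_cong:
  assumes "\<And>i j. i < n \<Longrightarrow> j < n \<Longrightarrow> a i j = b i j"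
  shows "detf n a = detf n b"
  by (rule arg_cong[where f = Determinant.det]) (auto intro!: eq_matI simp: assms)

lemma detf_leibniz:
  "detf n a = (\<Sum>\<pi> | \<pi> permutes {0..<n}. signof \<pi> * (\<Prod>i<n. a i (\<pi> i)))"
proof -
  have "detf n a = (\<Sum>\<pi> | \<pi> permutes {0..<n}.
      signof \<pi> * (\<Prod>i = 0..<n. Matrix.mat n n (\<lambda>(i, j). a i j) $$ (i, \<pi> i)))"
    by (rule det_def') simp
  also have "\<dots> = (\<Sum>\<pi> | \<pi> permutes {0..<n}. signof \<pi> * (\<Prod>i<n. a i (\<pi> i)))"
    by (intro sum.cong refl arg_cong2[where f = "(*)"] prod.cong)
      (auto simp: lessThan_atLeast0 permutes_in_image dest: permutes_in_image)
  finally show ?thesis .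
qed

lemma detf_mult: "detf n (\<lambda>i j. \<Sum>k<n. a i k * b k j) = detf n a * detf n b"
proof -
  have "detf n (\<lambda>i j. \<Sum>k<n. a i k * b k j) =
      Determinant.det (Matrix.mat n n (\<lambda>(i, j). a i j) * Matrix.mat n n (\<lambda>(i, j). b i j))"
    by (rule arg_cong[where f = Determinant.det])
      (auto intro!: eq_matI simp: scalar_prod_def lessThan_atLeast0)
  also have "\<dots> = detf n a * detf n b"
    by (rule det_mult) auto
  finally show ?thesis .
qed

lemma detf_lower_triangular:
  assumes "\<And>i j. i < j \<Longrightarrow> j < n \<Longrightarrow> a i j = 0"
  shows "detf n a = (\<Prod>i<n. a i i)"
proof -
  have "detf n a = prod_list (diag_mat (Matrix.mat n n (\<lambda>(i, j). a i j)))"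
    by (rule det_lower_triangular[where n = n]) (use assms in auto)
  also have "\<dots> = (\<Prod>i<n. a i i)"
    by (subst prod_list_diag_prod) (simp add: lessThan_atLeast0)
  finally show ?thesis .
qed

lemma detf_upper_triangular:
  assumes "\<And>i j. j < i \<Longrightarrow> i < n \<Longrightarrow> a i j = 0"
  shows "detf n a = (\<Prod>i<n. a i i)"
proof -
  have "detf n a = prod_list (diag_mat (Matrix.mat n n (\<lambda>(i, j). a i j)))"
    by (rule det_upper_triangular[where n = n]) (use assms in \<open>auto simp: upper_triangular_def\<close>)
  also have "\<dots> = (\<Prod>i<n. a i i)"
    by (subst prod_list_diag_prod) (simp add: lessThan_atLeast0)
  finally show ?thesis .
qed

lemma detf_scale_rows: "detf n (\<lambda>i j. c i * a i j) = (\<Prod>i<n. c i) * detf n a"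
  by (simp add: detf_leibniz sum_distrib_left prod.distrib mult_ac)

text \<open>
  Replacing rows by their partial sums is multiplication by the lower triangular matrix of ones.
\<close>

lemma detf_partial_sums: "detf n (\<lambda>i j. \<Sum>l\<le>i. a l j) = detf n a"
proof -
  let ?L = "\<lambda>i l. if l \<le> i then 1 else 0 :: real"
  have "detf n (\<lambda>i j. \<Sum>l\<le>i. a l j) = detf n (\<lambda>i j. \<Sum>k<n. ?L i k * a k j)"
  proof (rule detf_cong)
    fix i j assume "i < n" "j < n"
    have "(\<Sum>l\<le>i. a l j) = (\<Sum>l\<in>{l\<in>{..<n}. l \<le> i}. a l j)"
      by (rule sum.cong) (use \<open>i < n\<close> in auto)
    also have "\<dots> = (\<Sum>k<n. if k \<le> i then a k j else 0)"
      by (rule sum.inter_filter) simp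
    also have "\<dots> = (\<Sum>k<n. ?L i k * a k j)"
      by (rule sum.cong) auto
    finally show "(\<Sum>l\<le>i. a l j) = (\<Sum>k<n. ?L i k * a k j)" .
  qed
  also have "\<dots> = detf n ?L * detf n a" by (rule detf_mult)
  also have "detf n ?L = 1" by (subst detf_lower_triangular) auto
  finally show ?thesis by simp
qed

lemma partial_sums_of_differences:
  fixes T :: "nat \<Rightarrow> 'a :: ab_group_add"
  shows "(\<Sum>l\<le>i. case l of 0 \<Rightarrow> T 0 | Suc l' \<Rightarrow> T l - T l') = T i"
  by (induction i) auto

lemma detf_first_column_unit:
  assumes "\<And>i. 0 < i \<Longrightarrow> i < Suc n \<Longrightarrow> a i 0 = 0"
  shows "detf (Suc n) a = a 0 0 * detf n (\<lambda>i j. a (Suc i) (Suc j))"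
proof -
  let ?M = "Matrix.mat (Suc n) (Suc n) (\<lambda>(i, j). a i j)"
  have "detf (Suc n) a = (\<Sum>i<Suc n. ?M $$ (i, 0) * cofactor ?M i 0)"
    by (rule laplace_expansion_column) auto
  also have "\<dots> = a 0 0 * cofactor ?M 0 0"
    unfolding sum.lessThan_Suc_shift by (simp add: assms)
  also have "mat_delete ?M 0 0 = Matrix.mat n n (\<lambda>(i, j). a (Suc i) (Suc j))"
    by (rule eq_matI) (auto simp: mat_delete_def)
  then have "cofactor ?M 0 0 = detf n (\<lambda>i j. a (Suc i) (Suc j))"
    by (simp add: cofactor_def)
  finally show ?thesis .
qed

lemma detf_last_row_unit:
  assumes "\<And>j. 0 < j \<Longrightarrow> j < Suc n \<Longrightarrow> a n j = 0"
  shows "detf (Suc n) a = (- 1) ^ n * a n 0 * detf n (\<lambda>i j. a i (Suc j))"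
proof -
  let ?M = "Matrix.mat (Suc n) (Suc n) (\<lambda>(i, j). a i j)"
  have "detf (Suc n) a = (\<Sum>j<Suc n. ?M $$ (n, j) * cofactor ?M n j)"
    by (rule laplace_expansion_row) auto
  also have "\<dots> = a n 0 * cofactor ?M n 0"
    unfolding sum.lessThan_Suc_shift by (simp add: assms)
  also have "mat_delete ?M n 0 = Matrix.mat n n (\<lambda>(i, j). a i (Suc j))"
    by (rule eq_matI) (auto simp: mat_delete_def)
  then have "cofactor ?M n 0 = (- 1) ^ n * detf n (\<lambda>i j. a i (Suc j))"
    by (simp add: cofactor_def)
  finally show ?thesis by simp
qed

definition vandermonde_seq :: "nat \<Rightarrow> (nat \<Rightarrow> real) \<Rightarrow> real" where
  "vandermonde_seq n x = (\<Prod>j<n. \<Prod>i<j. x j - x i)"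

lemma vandermonde_eq_seq: "vandermonde X = vandermonde_seq (card X) (point X)"
  by (simp add: vandermonde_def vandermonde_seq_def)

text \<open>
  The matrix of values is the product of the matrix of powers with the upper triangular matrix
  of coefficients.
\<close>

lemma detf_poly_monomial:
  assumes "\<And>j. j < n \<Longrightarrow> degree (p j) \<le> j"
  shows "detf n (\<lambda>i j. poly (p j) (x i)) = detf n (\<lambda>i k. x i ^ k) * (\<Prod>j<n. coeff (p j) j)"
proof -
  have "detf n (\<lambda>i j. poly (p j) (x i)) = detf n (\<lambda>i j. \<Sum>k<n. x i ^ k * coeff (p j) k)"
  proof (rule detf_cong)
    fix i j assume "i < n" "j < n"
    have "poly (p j) (x i) = (\<Sum>k\<le>degree (p j). coeff (p j) k * x i ^ k)"
      by (rule poly_altdef)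
    also have "\<dots> = (\<Sum>k<n. coeff (p j) k * x i ^ k)"
      using assms[OF \<open>j < n\<close>] \<open>j < n\<close>
      by (intro sum.mono_neutral_left) (auto simp: coeff_eq_0)
    finally show "poly (p j) (x i) = (\<Sum>k<n. x i ^ k * coeff (p j) k)"
      by (simp add: mult.commute)
  qed
  also have "\<dots> = detf n (\<lambda>i k. x i ^ k) * detf n (\<lambda>k j. coeff (p j) k)"
    by (rule detf_mult)
  also have "detf n (\<lambda>k j. coeff (p j) k) = (\<Prod>j<n. coeff (p j) j)"
  proof (rule detf_upper_triangular)
    fix i j assume "j < i" "i < n"
    then show "coeff (p j) i = 0" using assms[of j] by (intro coeff_eq_0) auto
  qed
  finally show ?thesis .
qed

text \<open>
  The leading coefficients can be split off by the previous lemma, so one family of monic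
  polynomials suffices. The Newton polynomials \<open>\<Prod>\<^bsub>k<j\<^esub> (X - x\<^sub>k)\<close> make the matrix lower
  triangular with the factors of the Vandermonde product on the diagonal.
\<close>

lemma detf_poly:
  assumes "\<And>j. j < n \<Longrightarrow> degree (p j) \<le> j"
  shows "detf n (\<lambda>i j. poly (p j) (x i)) = (\<Prod>j<n. coeff (p j) j) * vandermonde_seq n x"
proof -
  define newton where "newton j = (\<Prod>k<j. [:- x k, 1:])" for j
  have deg: "degree (newton j) = j" and lead: "coeff (newton j) j = 1" for j
  proof -
    show d: "degree (newton j) = j"
      unfolding newton_def by (subst degree_prod_eq_sum_degree) auto
    have "lead_coeff (newton j) = 1"
      unfolding newton_def lead_coeff_prod by (simp add: lead_coeff_pCons)
    with d show "coeff (newton j) j = 1" by simp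
  qed
  have val: "poly (newton j) (x i) = (\<Prod>k<j. x i - x k)" for i j
    by (simp add: newton_def poly_prod)
  have "detf n (\<lambda>i k. x i ^ k) = detf n (\<lambda>i j. poly (newton j) (x i))"
    using detf_poly_monomial[of n newton x] by (simp add: deg lead)
  also have "\<dots> = vandermonde_seq n x"
    unfolding val vandermonde_seq_def
  proof (rule detf_lower_triangular)
    fix i j assume "i < j" "j < n"
    then show "(\<Prod>k<j. x i - x k) = 0" by (intro prod_zero) auto
  qed
  finally show ?thesis using detf_poly_monomial[of n p x] assms by simp
qed

section \<open>Summation over configurations with independent points\<close>

lemma has_sum_sum_functions:
  fixes f :: "'a \<Rightarrow> 'b \<Rightarrow> real"
  assumes "\<And>i. i \<in> I \<Longrightarrow> (f i has_sum s i) A"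
  shows "((\<lambda>x. \<Sum>i\<in>I. f i x) has_sum (\<Sum>i\<in>I. s i)) A"
  using assms by (induction I rule: infinite_finite_induct) (auto intro!: has_sum_add)

text \<open>
  In the Leibniz expansion every term is a product of functions of separate coordinates, and
  absolutely convergent sums of such products factorize.
\<close>

lemma has_sum_detf:
  assumes count: "\<And>i. i < n \<Longrightarrow> countable (A i)"
    and abs: "\<And>i j. i < n \<Longrightarrow> j < n \<Longrightarrow> Infinite_Sum.abs_summable_on (h j) (A i)"
  shows "((\<lambda>g. detf n (\<lambda>i j. h j (g i))) has_sum detf n (\<lambda>i j. \<Sum>\<^sub>\<infinity>x\<in>A i. h j x)) (PiE {..<n} A)"
  unfolding detf_leibniz
proof (intro has_sum_sum_functions has_sum_cmult_right)
  fix \<pi> assume "\<pi> \<in> {\<pi>. \<pi> permutes {0..<n}}"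
  then have \<pi>: "\<pi> i < n" if "i < n" for i
    using that permutes_in_image[of \<pi> "{0..<n}" i] by auto
  have "Infinite_Sum.abs_summable_on (\<lambda>g. \<Prod>i<n. h (\<pi> i) (g i)) (PiE {..<n} A)"
    unfolding abs_summable_equivalent
    by (rule abs_summable_on_prod_PiE)
      (use count abs \<pi> in \<open>auto simp flip: abs_summable_equivalent\<close>)
  then have "(\<lambda>g. \<Prod>i<n. h (\<pi> i) (g i)) summable_on (PiE {..<n} A)"
    by (rule abs_summable_summable)
  moreover have "(\<Sum>\<^sub>\<infinity>g\<in>PiE {..<n} A. \<Prod>i<n. h (\<pi> i) (g i)) = (\<Prod>i<n. \<Sum>\<^sub>\<infinity>x\<in>A i. h (\<pi> i) x)"
    by (rule infsum_prod_PiE_abs) (use abs \<pi> in auto)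
  ultimately show "((\<lambda>g. \<Prod>i<n. h (\<pi> i) (g i)) has_sum (\<Prod>i<n. \<Sum>\<^sub>\<infinity>x\<in>A i. h (\<pi> i) x)) (PiE {..<n} A)"
    by (simp add: has_sum_iff)
qed

lemma point_image:
  assumes "strict_mono_on {..<n} g" "i < n"
  shows "point (g ` {..<n}) i = g i"
proof -
  have "sorted_list_of_set (g ` {..<n}) = sorted_list_of_set (set (map g [0..<n]))"
    by (simp add: lessThan_atLeast0)
  also have "\<dots> = map g [0..<n]"
  proof (rule sorted_list_of_set.idem_if_sorted_distinct)
    show "sorted (map g [0..<n])"
      using assms(1) by (auto simp: sorted_iff_nth_mono_less strict_mono_on_def less_imp_le)
    show "distinct (map g [0..<n])"
      using strict_mono_on_imp_inj_on[OF assms(1)] by (simp add: distinct_map lessThan_atLeast0)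
  qed
  finally show ?thesis using assms(2) by (simp add: point_def)
qed

lemma point_strict_mono:
  assumes "finite X" "i < j" "j < card X"
  shows "point X i < point X j"
proof -
  have "sorted_wrt (<) (sorted_list_of_set X)"
    by (simp)
  then show ?thesis
    using assms by (auto simp: point_def sorted_wrt_iff_nth_less)
qed

lemma point_surj:
  assumes "finite X"
  shows "point X ` {..<card X} = X"
proof -
  have "X = set (sorted_list_of_set X)" using assms by simp
  also have "\<dots> = point X ` {..<card X}"
    using assms by (auto simp: set_conv_nth point_def image_iff)
  finally show ?thesis by simp
qed

lemma point_mem: "finite X \<Longrightarrow> i < card X \<Longrightarrow> point X i \<in> X"
  using point_surj by blast

lemma point_inj:
  assumes "finite X"
  shows "inj_on (point X) {..<card X}"
  by (rule strict_mono_on_imp_inj_on, rule strict_mono_onI) (use point_strict_mono[OF assms] in auto)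

lemma prod_point:
  assumes "finite X"
  shows "(\<Prod>i<card X. f (point X i)) = (\<Prod>x\<in>X. f x)"
  using prod.reindex[OF point_inj[OF assms], of f] by (simp add: point_surj assms)

lemma vandermonde_pos: "finite X \<Longrightarrow> 0 < vandermonde X"
  unfolding vandermonde_def by (intro prod_pos) (use point_strict_mono in auto)

text \<open>
  Each index belongs to \<open>n\<close> of the pairs.
\<close>

lemma prod_pairs_eq_prod_power:
  fixes u :: "nat \<Rightarrow> real"
  shows "(\<Prod>j<Suc n. \<Prod>i<j. u j * u i) = (\<Prod>i<Suc n. u i ^ n)"
proof (induction n)
  case (Suc n)
  have "(\<Prod>j<Suc (Suc n). \<Prod>i<j. u j * u i) =
      (\<Prod>i<Suc n. u i ^ n) * (\<Prod>i<Suc n. u (Suc n) * u i)"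
    using Suc.IH by simp
  also have "\<dots> = (\<Prod>i<Suc n. u i ^ n * u i) * u (Suc n) ^ Suc n"
    unfolding prod.distrib by (simp add: mult_ac)
  also have "\<dots> = (\<Prod>i<Suc (Suc n). u i ^ Suc n)"
    by (simp add: mult_ac)
  finally show ?case .
qed simp

text \<open>
  The bound \<open>\<bar>x - y\<bar> \<le> (1 + \<bar>x\<bar>) (1 + \<bar>y\<bar>)\<close> separates the variables; it reduces the
  convergence of sums over configurations to sums over single points.
\<close>

lemma vandermonde_le:
  assumes "finite X" "card X = Suc n"
  shows "vandermonde X \<le> (\<Prod>x\<in>X. (1 + \<bar>x\<bar>) ^ n)"
proof -
  have "vandermonde X \<le> (\<Prod>j<card X. \<Prod>i<j. (1 + \<bar>point X j\<bar>) * (1 + \<bar>point X i\<bar>))"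
    unfolding vandermonde_def
  proof (intro prod_mono conjI)
    fix j i assume "j \<in> {..<card X}" "i \<in> {..<j}"
    then have lt: "point X i < point X j" using assms(1) by (intro point_strict_mono) auto
    then show "0 \<le> point X j - point X i" by simp
    have "point X j - point X i \<le> \<bar>point X j\<bar> + \<bar>point X i\<bar>" by linarith
    also have "\<dots> \<le> (1 + \<bar>point X j\<bar>) * (1 + \<bar>point X i\<bar>)"
      by (simp add: algebra_simps)
    finally show "point X j - point X i \<le> (1 + \<bar>point X j\<bar>) * (1 + \<bar>point X i\<bar>)" .
  next
    fix j assume j: "j \<in> {..<card X}"
    show "0 \<le> (\<Prod>i<j. point X j - point X i)"
      by (rule prod_nonneg) (use j assms(1) in \<open>auto intro!: less_imp_le point_strict_mono\<close>)
  qed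
  also have "\<dots> = (\<Prod>i<card X. (1 + \<bar>point X i\<bar>) ^ n)"
    unfolding assms(2) by (rule prod_pairs_eq_prod_power)
  also have "\<dots> = (\<Prod>x\<in>X. (1 + \<bar>x\<bar>) ^ n)" by (rule prod_point[OF assms(1)])
  finally show ?thesis .
qed

text \<open>
  Both the configurations interlacing with a given larger one and those interlacing with a
  given smaller one have this form, with sets \<open>A i\<close> that lie one behind the other.
\<close>

definition chamber :: "nat \<Rightarrow> (nat \<Rightarrow> real set) \<Rightarrow> real set set" where
  "chamber n A = {X. finite X \<and> card X = n \<and> (\<forall>i<n. point X i \<in> A i)}"

lemma chamber_strict_mono:
  fixes A :: "nat \<Rightarrow> real set"
  assumes order: "\<And>i x y. Suc i < n \<Longrightarrow> x \<in> A i \<Longrightarrow> y \<in> A (Suc i) \<Longrightarrow> x < y"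
    and g: "g \<in> PiE {..<n} A"
  shows "strict_mono_on {..<n} g"
proof (rule strict_mono_onI)
  fix i j assume "i \<in> {..<n}" "j \<in> {..<n}" "i < j"
  then have "i < j" "j < n" by auto
  then show "g i < g j"
  proof (induction j)
    case (Suc k)
    then have "g k < g (Suc k)"
      using PiE_mem[OF g, of k] PiE_mem[OF g, of "Suc k"] by (intro order[of k]) auto
    moreover have "i < k \<Longrightarrow> g i < g k" using Suc by auto
    ultimately show ?case using \<open>i < Suc k\<close> by (cases "i = k") auto
  qed simp
qed

text \<open>
  When the sets \<open>A i\<close> lie one behind the other, any choice of elements is automatically
  increasing, so the points of a configuration vary independently.
\<close>

lemma chamber_bij:
  assumes "\<And>i x y. Suc i < n \<Longrightarrow> x \<in> A i \<Longrightarrow> y \<in> A (Suc i) \<Longrightarrow> x < y"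
  shows "bij_betw (\<lambda>g. g ` {..<n}) (PiE {..<n} A) (chamber n A)"
proof -
  have mono: "strict_mono_on {..<n} g" if "g \<in> PiE {..<n} A" for g
    using chamber_strict_mono[OF assms that] .
  show ?thesis
  proof (rule bij_betw_byWitness[where f' = "\<lambda>X. restrict (point X) {..<n}"])
    show "\<forall>g\<in>PiE {..<n} A. restrict (point (g ` {..<n})) {..<n} = g"
    proof
      fix g assume g: "g \<in> PiE {..<n} A"
      show "restrict (point (g ` {..<n})) {..<n} = g"
        using g by (intro extensionalityI[where A = "{..<n}"])
          (auto simp: point_image[OF mono[OF g]] PiE_def)
    qed
    show "\<forall>X\<in>chamber n A. restrict (point X) {..<n} ` {..<n} = X"
      using point_surj by (auto simp: chamber_def)
    show "(\<lambda>g. g ` {..<n}) ` PiE {..<n} A \<subseteq> chamber n A"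
      using point_image[OF mono] strict_mono_on_imp_inj_on[OF mono]
      by (auto simp: chamber_def card_image)
    show "(\<lambda>X. restrict (point X) {..<n}) ` chamber n A \<subseteq> PiE {..<n} A"
      by (auto simp: chamber_def intro!: restrict_PiE_iff[THEN iffD2])
  qed
qed

text \<open>
  The freedom in the choice of the polynomials is what makes the one-dimensional sums
  computable in the two applications.
\<close>

lemma chamber_sum:
  assumes order: "\<And>i x y. Suc i < n \<Longrightarrow> x \<in> A i \<Longrightarrow> y \<in> A (Suc i) \<Longrightarrow> x < y"
    and count: "\<And>i. i < n \<Longrightarrow> countable (A i)"
    and deg: "\<And>j. j < n \<Longrightarrow> degree (p j) \<le> j"
    and summable: "\<And>i j. i < n \<Longrightarrow> j < n \<Longrightarrow> (\<lambda>x. f x * poly (p j) x) summable_on A i"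
  shows "((\<lambda>X. (\<Prod>x\<in>X. f x) * vandermonde X * (\<Prod>j<n. coeff (p j) j)) has_sum
      detf n (\<lambda>i j. \<Sum>\<^sub>\<infinity>x\<in>A i. f x * poly (p j) x)) (chamber n A)"
proof -
  let ?F = "\<lambda>X. (\<Prod>x\<in>X. f x) * vandermonde X * (\<Prod>j<n. coeff (p j) j)"
  have val: "detf n (\<lambda>i j. f (g i) * poly (p j) (g i)) = ?F (g ` {..<n})"
    if g: "g \<in> PiE {..<n} A" for g
  proof -
    have mono: "strict_mono_on {..<n} g" using chamber_strict_mono[OF order g] .
    have inj: "inj_on g {..<n}" by (rule strict_mono_on_imp_inj_on[OF mono])
    have V: "vandermonde (g ` {..<n}) = vandermonde_seq n g"
      unfolding vandermonde_eq_seq vandermonde_seq_def card_image[OF inj] card_lessThan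
      by (intro prod.cong refl) (auto simp: point_image[OF mono])
    have "detf n (\<lambda>i j. f (g i) * poly (p j) (g i)) =
        (\<Prod>i<n. f (g i)) * ((\<Prod>j<n. coeff (p j) j) * vandermonde_seq n g)"
      using deg by (simp add: detf_scale_rows detf_poly)
    then show ?thesis by (simp add: V prod.reindex[OF inj] mult_ac)
  qed
  have "((\<lambda>g. detf n (\<lambda>i j. f (g i) * poly (p j) (g i))) has_sum
      detf n (\<lambda>i j. \<Sum>\<^sub>\<infinity>x\<in>A i. f x * poly (p j) x)) (PiE {..<n} A)"
    using summable[THEN summable_on_iff_abs_summable_on_real[THEN iffD1]]
    by (intro has_sum_detf[where h = "\<lambda>j x. f x * poly (p j) x"] count)
  also have "?this \<longleftrightarrow> ((\<lambda>g. ?F (g ` {..<n})) has_sum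
      detf n (\<lambda>i j. \<Sum>\<^sub>\<infinity>x\<in>A i. f x * poly (p j) x)) (PiE {..<n} A)"
    by (rule has_sum_cong) (rule val)
  also have "\<dots> \<longleftrightarrow> (?F has_sum detf n (\<lambda>i j. \<Sum>\<^sub>\<infinity>x\<in>A i. f x * poly (p j) x)) (chamber n A)"
    using order by (intro has_sum_reindex_bij_betw chamber_bij) auto
  finally show ?thesis .
qed

section \<open>The lattice, Jackson integrals and the stochasticity of the links\<close>

locale q_lattice =
  fixes q zm zp :: real
  assumes q_pos: "0 < q" and q_less_1: "q < 1" and zm_neg: "zm < 0" and zp_pos: "0 < zp"
begin

abbreviation L :: "real set" where "L \<equiv> Defs.lattice q zm zp"

abbreviation C :: "nat \<Rightarrow> real set set" where "C \<equiv> configs q zm zp"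

lemma q_nonzero [simp]: "q \<noteq> 0"
  using q_pos by simp

lemma lattice_cases:
  assumes "x \<in> L"
  obtains z m where "z = zm \<or> z = zp" "x = z * q powi m"
  using assms by (auto simp: Defs.lattice_def)

lemma lattice_nonzero: "x \<in> L \<Longrightarrow> x \<noteq> 0"
  using zm_neg zp_pos by (elim lattice_cases) auto

lemma zm_in_lattice: "zm \<in> L" and zp_in_lattice: "zp \<in> L"
proof -
  have "zm * q powi 0 \<in> L" "zp * q powi 0 \<in> L" unfolding Defs.lattice_def by blast+
  then show "zm \<in> L" "zp \<in> L" by simp_all
qed

lemma lattice_powi: "x \<in> L \<Longrightarrow> x * q powi k \<in> L"
proof (elim lattice_cases)
  fix z m assume z: "z = zm \<or> z = zp" and "x = z * q powi m"
  then have "x * q powi k = z * q powi (m + k)" by (simp add: power_int_add)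
  then show "x * q powi k \<in> L" using z by (auto simp: Defs.lattice_def)
qed

lemma lattice_mult_power: "x \<in> L \<Longrightarrow> x * q ^ k \<in> L"
  using lattice_powi[of x "int k"] by simp

lemma lattice_divide_power: "x \<in> L \<Longrightarrow> x / q ^ k \<in> L"
  using lattice_powi[of x "- int k"] by (simp add: power_int_minus_divide)

lemma lattice_divide: "x \<in> L \<Longrightarrow> x / q \<in> L"
  using lattice_divide_power[of x 1] by simp

lemma lattice_mult: "x \<in> L \<Longrightarrow> x * q \<in> L"
  using lattice_mult_power[of x 1] by simp

lemma countable_lattice: "countable L"
  by (simp add: Defs.lattice_def)

lemma lattice_same_sign:
  assumes "x \<in> L" "b \<in> L" "0 < x * b"
  obtains k :: int where "x = b * q powi k"
proof -
  obtain z m where z: "z = zm \<or> z = zp" "x = z * q powi m"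
    using assms(1) by (rule lattice_cases)
  obtain z' m' where z': "z' = zm \<or> z' = zp" "b = z' * q powi m'"
    using assms(2) by (rule lattice_cases)
  have "0 < (z * z') * (q powi m * q powi m')" using assms(3) z z' by (simp add: mult_ac)
  moreover have "0 < q powi m * q powi m'" using q_pos by simp
  ultimately have "0 < z * z'" by (rule zero_less_mult_pos2)
  then have "z = z'" using z(1) z'(1) zm_neg zp_pos by (auto simp: zero_less_mult_iff)
  then have "x = b * q powi (m - m')"
    using z z' by (simp add: power_int_diff)
  then show ?thesis by (rule that)
qed

text \<open>
  Rays are indexed by the exponent of \<open>q\<close>, which turns sums over them into ordinary series. All
  sums over subsets of the lattice below are assembled from rays.
\<close>

definition ray_in :: "real \<Rightarrow> real set" where
  "ray_in b = range (\<lambda>m::nat. b * q ^ m)"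

definition ray_out :: "real \<Rightarrow> real set" where
  "ray_out b = range (\<lambda>m::nat. b / q ^ m)"

lemma q_powi_le_1_iff: "q powi k \<le> 1 \<longleftrightarrow> 0 \<le> k"
proof
  show "q powi k \<le> 1" if "0 \<le> k"
    using that q_pos q_less_1 by (auto simp: power_int_def power_le_one)
  show "0 \<le> k" if "q powi k \<le> 1"
  proof (rule ccontr)
    assume "\<not> 0 \<le> k"
    then have "q powi k = inverse (q ^ nat (- k))" "nat (- k) \<noteq> 0" by (auto simp: power_int_def power_inverse)
    moreover have "q ^ nat (- k) < 1"
      using \<open>nat (- k) \<noteq> 0\<close> q_pos q_less_1 by (intro power_less_one_iff[THEN iffD2]) auto
    ultimately have "1 < q powi k" using q_pos by (simp add: one_less_inverse_iff)
    with that show False by simp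
  qed
qed

lemma ray_in_eq:
  assumes b: "b \<in> L"
  shows "ray_in b = {x \<in> L. 0 < x * b \<and> \<bar>x\<bar> \<le> \<bar>b\<bar>}"
proof (intro equalityI subsetI)
  fix x assume "x \<in> ray_in b"
  then obtain m where x: "x = b * q ^ m" by (auto simp: ray_in_def)
  have "0 < b * b" using lattice_nonzero[OF b] by (metis mult_eq_0_iff not_real_square_gt_zero)
  then have "0 < (b * b) * q ^ m" using zero_less_power[OF q_pos] by (rule mult_pos_pos)
  also have "(b * b) * q ^ m = x * b" by (simp add: x)
  finally have "0 < x * b" .
  moreover have "\<bar>x\<bar> \<le> \<bar>b\<bar>"
    using x q_pos q_less_1 by (simp add: abs_mult mult_left_le power_le_one)
  ultimately show "x \<in> {x \<in> L. 0 < x * b \<and> \<bar>x\<bar> \<le> \<bar>b\<bar>}"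
    using x lattice_mult_power[OF b] by simp
next
  fix x assume x: "x \<in> {x \<in> L. 0 < x * b \<and> \<bar>x\<bar> \<le> \<bar>b\<bar>}"
  then obtain k where k: "x = b * q powi k" using lattice_same_sign b by blast
  then have "q powi k \<le> 1" using x lattice_nonzero[OF b] q_pos by (simp add: abs_mult)
  then have "0 \<le> k" by (simp only: q_powi_le_1_iff)
  then have "x = b * q ^ nat k" using k by (simp add: power_int_def)
  then show "x \<in> ray_in b" by (auto simp: ray_in_def)
qed

lemma ray_out_eq:
  assumes b: "b \<in> L"
  shows "ray_out b = {x \<in> L. 0 < x * b \<and> \<bar>b\<bar> \<le> \<bar>x\<bar>}"
proof (intro equalityI subsetI)
  fix x assume "x \<in> ray_out b"
  then obtain m where x: "x = b / q ^ m" by (auto simp: ray_out_def)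
  then have x': "x \<in> L" "b = x * q ^ m" using lattice_divide_power[OF b] by auto
  then have "b \<in> ray_in x" by (auto simp: ray_in_def)
  then show "x \<in> {x \<in> L. 0 < x * b \<and> \<bar>b\<bar> \<le> \<bar>x\<bar>}"
    using x' by (auto simp: ray_in_eq mult.commute)
next
  fix x assume x: "x \<in> {x \<in> L. 0 < x * b \<and> \<bar>b\<bar> \<le> \<bar>x\<bar>}"
  then have "b \<in> ray_in x" using b by (auto simp: ray_in_eq mult.commute)
  then show "x \<in> ray_out b" by (auto simp: ray_in_def ray_out_def field_simps)
qed

lemma ray_in_subset: "b \<in> L \<Longrightarrow> ray_in b \<subseteq> L" and ray_out_subset: "b \<in> L \<Longrightarrow> ray_out b \<subseteq> L"
  by (auto simp: ray_in_eq ray_out_eq)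

text \<open>
  The next lattice point after \<open>b\<close> towards 0 is \<open>b * q\<close>.
\<close>

lemma ray_out_Un_ray_in:
  assumes "b \<in> L"
  shows "{x \<in> L. 0 < x * b} = ray_out b \<union> ray_in (b * q)" "ray_out b \<inter> ray_in (b * q) = {}"
proof -
  have *: "\<bar>x\<bar> \<le> \<bar>b * q\<bar> \<longleftrightarrow> \<bar>x\<bar> < \<bar>b\<bar>" if x: "x \<in> L" "0 < x * b" for x
  proof
    have "\<bar>b * q\<bar> < \<bar>b\<bar>"
      using lattice_nonzero[OF assms] q_pos q_less_1 by (simp add: abs_mult)
    then show "\<bar>x\<bar> < \<bar>b\<bar>" if "\<bar>x\<bar> \<le> \<bar>b * q\<bar>" using that by simp
    show "\<bar>x\<bar> \<le> \<bar>b * q\<bar>" if "\<bar>x\<bar> < \<bar>b\<bar>"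
    proof -
      have "x \<in> ray_in b" using that x assms by (auto simp: ray_in_eq)
      then obtain m where m: "x = b * q ^ m" by (auto simp: ray_in_def)
      with that have "m \<noteq> 0" by (auto intro: Nat.gr0I)
      then obtain l where "m = Suc l" by (cases m) auto
      then have "x = b * q * q ^ l" using m by simp
      then have "x \<in> ray_in (b * q)" by (auto simp: ray_in_def)
      then show ?thesis using lattice_mult[OF assms] by (auto simp: ray_in_eq)
    qed
  qed
  have sgn: "0 < x * (b * q) \<longleftrightarrow> 0 < x * b" for x
    using q_pos by (simp add: zero_less_mult_iff mult_less_0_iff)
  show "{x \<in> L. 0 < x * b} = ray_out b \<union> ray_in (b * q)" "ray_out b \<inter> ray_in (b * q) = {}"
    using assms lattice_mult[OF assms] * by (auto simp: ray_out_eq ray_in_eq sgn)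
qed

lemma has_sum_ray_in_iff:
  assumes "b \<noteq> 0"
  shows "(f has_sum s) (ray_in b) \<longleftrightarrow> ((\<lambda>m. f (b * q ^ m)) has_sum s) UNIV"
proof -
  have "inj (\<lambda>m. b * q ^ m)"
    using assms q_pos q_less_1 by (auto intro!: injI simp: power_inject_exp')
  then show ?thesis by (simp add: ray_in_def has_sum_reindex o_def)
qed

lemma has_sum_ray_out_iff:
  assumes "b \<noteq> 0"
  shows "(f has_sum s) (ray_out b) \<longleftrightarrow> ((\<lambda>m. f (b / q ^ m)) has_sum s) UNIV"
proof -
  have "inj (\<lambda>m. b / q ^ m)"
    using assms q_pos q_less_1 by (auto intro!: injI simp: power_inject_exp')
  then show ?thesis by (simp add: ray_out_def has_sum_reindex o_def)
qed

text \<open>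
  A geometric series with ratio \<open>q\<^bsup>k+1\<^esup>\<close>.
\<close>

lemma q_integral_ray_in:
  assumes "b \<in> L"
  shows "((\<lambda>y. \<bar>y\<bar> * ((1 - q ^ Suc k) * y ^ k)) has_sum \<bar>b\<bar> * b ^ k) (ray_in b)"
proof -
  have qk: "0 < q ^ Suc k" "q ^ Suc k < 1"
    using q_pos q_less_1 by (auto simp del: power_Suc intro!: power_less_one_iff[THEN iffD2])
  have "(\<lambda>m. (q ^ Suc k) ^ m) sums (1 / (1 - q ^ Suc k))"
    using qk by (intro geometric_sums) (simp del: power_Suc)
  then have "((\<lambda>m. (q ^ Suc k) ^ m) has_sum (1 / (1 - q ^ Suc k))) UNIV"
    using qk by (intro sums_nonneg_imp_has_sum) (simp_all del: power_Suc)
  then have "((\<lambda>m. \<bar>b\<bar> * b ^ k * (1 - q ^ Suc k) * (q ^ Suc k) ^ m) has_sum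
      \<bar>b\<bar> * b ^ k * (1 - q ^ Suc k) * (1 / (1 - q ^ Suc k))) UNIV"
    by (rule has_sum_cmult_right)
  also have "\<bar>b\<bar> * b ^ k * (1 - q ^ Suc k) * (1 / (1 - q ^ Suc k)) = \<bar>b\<bar> * b ^ k"
    using qk by simp
  also have "(\<lambda>m. \<bar>b\<bar> * b ^ k * (1 - q ^ Suc k) * (q ^ Suc k) ^ m) =
      (\<lambda>m. \<bar>b * q ^ m\<bar> * ((1 - q ^ Suc k) * (b * q ^ m) ^ k))"
    using q_pos
    by (auto simp: abs_mult power_mult_distrib mult_ac simp flip: power_mult power_add)
  finally show ?thesis using lattice_nonzero[OF assms] by (simp add: has_sum_ray_in_iff)
qed

abbreviation I :: "real \<Rightarrow> real \<Rightarrow> real set" where "I \<equiv> interlacing_interval q zm zp"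

text \<open>
  The Jackson integral of a monomial. Which endpoint belongs to the interval depends on the
  signs exactly so that the interval is a difference or a disjoint union of rays towards 0.
\<close>

lemma q_integral:
  assumes a: "a \<in> L" and b: "b \<in> L" and "a < b"
  shows "((\<lambda>y. \<bar>y\<bar> * ((1 - q ^ Suc k) * y ^ k)) has_sum (b ^ Suc k - a ^ Suc k)) (I a b)"
proof -
  have nz: "a \<noteq> 0" "b \<noteq> 0" using a b lattice_nonzero by auto
  consider "b < 0" | "a < 0" "0 < b" | "0 < a" using nz by linarith
  then show ?thesis
  proof cases
    case 1
    then have eq: "I a b = ray_in a - ray_in b"
      using \<open>a < b\<close> lattice_nonzero
      by (auto simp: interlacing_interval_def ray_in_eq a b zero_less_mult_iff)
    have "ray_in b \<subseteq> ray_in a" using 1 \<open>a < b\<close>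
      by (auto simp: ray_in_eq a b zero_less_mult_iff)
    from has_sum_Diff[OF q_integral_ray_in[OF a] q_integral_ray_in[OF b] this]
    show ?thesis using 1 \<open>a < b\<close> by (simp add: eq)
  next
    case 2
    then have eq: "I a b = ray_in a \<union> ray_in b" and disj: "ray_in a \<inter> ray_in b = {}"
      using lattice_nonzero
      by (force simp: interlacing_interval_def ray_in_eq a b zero_less_mult_iff)+
    from has_sum_Un_disjoint[OF q_integral_ray_in[OF a] q_integral_ray_in[OF b] disj]
    show ?thesis using 2 by (simp add: eq)
  next
    case 3
    then have eq: "I a b = ray_in b - ray_in a"
      using \<open>a < b\<close> lattice_nonzero
      by (auto simp: interlacing_interval_def ray_in_eq a b zero_less_mult_iff)
    have "ray_in a \<subseteq> ray_in b" using 3 \<open>a < b\<close>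
      by (auto simp: ray_in_eq a b zero_less_mult_iff)
    from has_sum_Diff[OF q_integral_ray_in[OF b] q_integral_ray_in[OF a] this]
    show ?thesis using 3 \<open>a < b\<close> by (simp add: eq)
  qed
qed

lemma configsD:
  assumes "X \<in> C N"
  shows "finite X" "card X = N" "X \<subseteq> L" and "i < N \<Longrightarrow> point X i \<in> L"
  using assms point_mem[of X i] by (auto simp: configs_def)

lemma chamber_subset_configs:
  assumes "\<And>i. i < N \<Longrightarrow> A i \<subseteq> L"
  shows "chamber N A \<subseteq> C N"
proof
  fix X assume "X \<in> chamber N A"
  then have X: "finite X" "card X = N" "\<And>i. i < N \<Longrightarrow> point X i \<in> A i" by (auto simp: chamber_def)
  then have "point X ` {..<card X} \<subseteq> L" using assms by auto
  then have "X \<subseteq> L" using X(1) by (simp only: point_surj)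
  then show "X \<in> C N" using X by (simp add: configs_def)
qed

text \<open>
  Bordering by the row \<open>(1, x\<^sub>0, x\<^sub>0\<^sup>2, \<dots>)\<close> and a first column that vanishes below it does not
  change the determinant, and partial row sums then turn the differences into powers.
\<close>

lemma detf_differences:
  "detf N (\<lambda>i j. x (Suc i) ^ Suc j - x i ^ Suc j) = vandermonde_seq (Suc N) x"
proof -
  define a where "a i j = (case i of 0 \<Rightarrow> x 0 ^ j | Suc i' \<Rightarrow> x i ^ j - x i' ^ j)" for i j
  have "detf N (\<lambda>i j. x (Suc i) ^ Suc j - x i ^ Suc j) = detf (Suc N) a"
    by (subst detf_first_column_unit) (auto simp: a_def split: nat.splits)
  also have "\<dots> = detf (Suc N) (\<lambda>i j. \<Sum>l\<le>i. a l j)"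
    by (rule detf_partial_sums[symmetric])
  also have "(\<lambda>i j. \<Sum>l\<le>i. a l j) = (\<lambda>i j. poly (monom 1 j) (x i))"
  proof (intro ext)
    fix i j show "(\<Sum>l\<le>i. a l j) = poly (monom 1 j) (x i)"
      by (induction i) (auto simp: a_def poly_monom)
  qed
  also have "detf (Suc N) \<dots> = vandermonde_seq (Suc N) x"
    by (subst detf_poly) (auto simp: degree_monom_le)
  finally show ?thesis .
qed

text \<open>
  The points of \<open>Y\<close> vary independently over the intervals between the points of \<open>X\<close>. With the
  factor \<open>1 - q\<^bsup>j+1\<^esup>\<close> absorbed into the polynomial of degree \<open>j\<close>, the one-dimensional sums are
  differences of powers.
\<close>

lemma qlink_stochastic:
  assumes X: "X \<in> C (Suc N)"
  shows "(qlink q zm zp N X has_sum 1) (C N)"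
proof -
  note Xp = configsD[OF X]
  define A where "A i = I (point X i) (point X (Suc i))" for i
  define p where "p j = monom (1 - q ^ Suc j) j" for j
  have mono: "point X i < point X (Suc i)" if "i < N" for i
    using that Xp by (intro point_strict_mono) auto
  have AL: "A i \<subseteq> L" for i by (auto simp: A_def interlacing_interval_def)
  have p: "poly (p j) y = (1 - q ^ Suc j) * y ^ j" "coeff (p j) j = 1 - q ^ Suc j" "degree (p j) \<le> j" for j y
    by (simp_all add: p_def poly_monom degree_monom_le)
  have int: "((\<lambda>y. \<bar>y\<bar> * poly (p j) y) has_sum (point X (Suc i) ^ Suc j - point X i ^ Suc j)) (A i)"
    if "i < N" for i j
    unfolding A_def p using q_integral[OF _ _ mono[OF that]] Xp(4) that by simp
  have "((\<lambda>Y. (\<Prod>y\<in>Y. \<bar>y\<bar>) * vandermonde Y * (\<Prod>j<N. coeff (p j) j)) has_sum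
      detf N (\<lambda>i j. \<Sum>\<^sub>\<infinity>y\<in>A i. \<bar>y\<bar> * poly (p j) y)) (chamber N A)"
  proof (rule chamber_sum)
    fix i x y assume "Suc i < N" "x \<in> A i" "y \<in> A (Suc i)"
    then show "x < y" using mono[of i] mono[of "Suc i"]
      by (auto simp: A_def interlacing_interval_def split: if_splits)
  next
    show "countable (A i)" for i
      by (rule countable_subset[OF AL countable_lattice])
    show "degree (p j) \<le> j" for j by (rule p)
    show "(\<lambda>y. \<bar>y\<bar> * poly (p j) y) summable_on A i" if "i < N" for i j
      using int[OF that] by (rule has_sum_imp_summable)
  qed
  also have "detf N (\<lambda>i j. \<Sum>\<^sub>\<infinity>y\<in>A i. \<bar>y\<bar> * poly (p j) y) =
      detf N (\<lambda>i j. point X (Suc i) ^ Suc j - point X i ^ Suc j)"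
    by (rule detf_cong) (rule infsumI[OF int])
  also have "\<dots> = vandermonde X" by (simp only: detf_differences vandermonde_eq_seq Xp(2))
  finally have "((\<lambda>Y. (\<Prod>y\<in>Y. \<bar>y\<bar>) * vandermonde Y * (\<Prod>j<N. coeff (p j) j) * (1 / vandermonde X)) has_sum
      vandermonde X * (1 / vandermonde X)) (chamber N A)"
    by (rule has_sum_cmult_left)
  moreover have "vandermonde X > 0" using Xp by (intro vandermonde_pos)
  moreover have "(\<Prod>j<N. coeff (p j) j) = (\<Prod>k=1..N. 1 - q ^ k)"
    using prod.atLeast1_atMost_eq[of "\<lambda>k. 1 - q ^ k" N] by (simp add: p)
  ultimately have "((\<lambda>Y. (\<Prod>y\<in>Y. \<bar>y\<bar>) * (\<Prod>k=1..N. 1 - q ^ k) * (vandermonde Y / vandermonde X)) has_sum 1)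
      (chamber N A)"
    by (simp add: mult_ac)
  also have "?this \<longleftrightarrow> ?thesis"
  proof (rule has_sum_cong_neutral)
    fix Y assume "Y \<in> C N - chamber N A"
    then show "qlink q zm zp N X Y = 0"
      by (auto simp: qlink_def interlaces_def chamber_def configs_def A_def)
  next
    fix Y assume "Y \<in> chamber N A - C N"
    then show "(\<Prod>y\<in>Y. \<bar>y\<bar>) * (\<Prod>k=1..N. 1 - q ^ k) * (vandermonde Y / vandermonde X) = 0"
      using chamber_subset_configs AL by blast
  next
    fix Y assume "Y \<in> chamber N A \<inter> C N"
    then have "interlaces q zm zp N Y X"
      by (auto simp: interlaces_def chamber_def A_def)
    then show "(\<Prod>y\<in>Y. \<bar>y\<bar>) * (\<Prod>k=1..N. 1 - q ^ k) * (vandermonde Y / vandermonde X) = qlink q zm zp N X Y"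
      by (simp add: qlink_def)
  qed
  finally show ?thesis .
qed

end

section \<open>The weights and their growth\<close>

text \<open>
  This is \<open>(1 - a x) (1 - b x)\<close> for \<open>c1 = a + b\<close> and \<open>c2 = a b\<close>. It is real for both kinds of
  admissible pairs, including conjugate ones.
\<close>

definition quad :: "real \<Rightarrow> real \<Rightarrow> real \<Rightarrow> real" where
  "quad c1 c2 x = 1 - c1 * x + c2 * x ^ 2"

text \<open>
  The product \<open>(a x, b x; q)\<^sub>\<infinity>\<close>, again through the sum and the product of \<open>a\<close> and \<open>b\<close>.
\<close>

definition qprod :: "real \<Rightarrow> real \<Rightarrow> real \<Rightarrow> real \<Rightarrow> real" where
  "qprod q c1 c2 x = prodinf (\<lambda>m. quad c1 c2 (x * q ^ m))"

lemma convergent_qprod: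
  fixes q :: real
  assumes q: "0 < q" "q < 1"
  shows "convergent_prod (\<lambda>m. quad c1 c2 (x * q ^ m))"
proof (rule abs_convergent_prod_imp_convergent_prod, rule summable_imp_abs_convergent_prod)
  show "summable (\<lambda>m. norm (quad c1 c2 (x * q ^ m) - 1))"
  proof (rule summable_comparison_test')
    show "summable (\<lambda>m. (\<bar>c1 * x\<bar> + \<bar>c2 * x ^ 2\<bar>) * q ^ m)"
      using q by (intro summable_mult summable_geometric) simp
    fix m
    have "quad c1 c2 (x * q ^ m) - 1 = - (c1 * x) * q ^ m + c2 * x ^ 2 * (q ^ m) ^ 2"
      by (simp add: quad_def power_mult_distrib)
    then have "\<bar>quad c1 c2 (x * q ^ m) - 1\<bar> \<le> \<bar>(c1 * x) * q ^ m\<bar> + \<bar>c2 * x ^ 2 * (q ^ m) ^ 2\<bar>"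
      by (simp only: abs_triangle_ineq[THEN order_trans] abs_minus_cancel mult_minus_left)
    also have "\<dots> = \<bar>c1 * x\<bar> * q ^ m + \<bar>c2 * x ^ 2\<bar> * (q ^ m) ^ 2"
      using q by (simp add: abs_mult)
    also have "(q ^ m) ^ 2 \<le> q ^ m"
      using q by (simp add: power2_eq_square mult_left_le power_le_one)
    then have "\<bar>c1 * x\<bar> * q ^ m + \<bar>c2 * x ^ 2\<bar> * (q ^ m) ^ 2 \<le> \<bar>c1 * x\<bar> * q ^ m + \<bar>c2 * x ^ 2\<bar> * q ^ m"
      by (intro add_left_mono mult_left_mono) auto
    finally show "norm (norm (quad c1 c2 (x * q ^ m) - 1)) \<le> (\<bar>c1 * x\<bar> + \<bar>c2 * x ^ 2\<bar>) * q ^ m"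
      by (simp add: algebra_simps)
  qed
qed

locale positive_qprod =
  fixes q c1 c2 x :: real
  assumes q: "0 < q" "q < 1" and pos: "\<And>m. 0 < quad c1 c2 (x * q ^ m)"
begin

lemma qprod_pos: "0 < qprod q c1 c2 x"
  unfolding qprod_def
  by (rule has_prod_pos[OF convergent_prod_has_prod[OF convergent_qprod[OF q]]]) (rule pos)

lemma qprod_split: "qprod q c1 c2 x = qprod q c1 c2 (x * q ^ n) * (\<Prod>m<n. quad c1 c2 (x * q ^ m))"
  unfolding qprod_def
  by (subst prodinf_split_initial_segment[OF convergent_qprod[OF q], of n])
    (use pos in \<open>auto simp: less_imp_neq[symmetric] power_add mult_ac\<close>)

lemma qprod_step: "qprod q c1 c2 x = quad c1 c2 x * qprod q c1 c2 (x * q)"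
  using qprod_split[of 1] by simp

text \<open>
  The values along this orbit are the tails of a convergent product with nonzero value.
\<close>

lemma qprod_tendsto_1: "(\<lambda>m. qprod q c1 c2 (x * q ^ m)) \<longlonglongrightarrow> 1"
proof -
  let ?P = "\<lambda>n. \<Prod>m<n. quad c1 c2 (x * q ^ m)"
  have "(\<lambda>n. \<Prod>m\<le>n. quad c1 c2 (x * q ^ m)) \<longlonglongrightarrow> qprod q c1 c2 x"
    unfolding qprod_def by (rule convergent_prod_LIMSEQ[OF convergent_qprod[OF q]])
  then have "?P \<longlonglongrightarrow> qprod q c1 c2 x"
    by (subst filterlim_sequentially_Suc[symmetric]) (simp add: lessThan_Suc_atMost)
  then have "(\<lambda>n. qprod q c1 c2 x / ?P n) \<longlonglongrightarrow> qprod q c1 c2 x / qprod q c1 c2 x"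
    using qprod_pos by (intro tendsto_divide tendsto_const) auto
  moreover have "qprod q c1 c2 x / ?P n = qprod q c1 c2 (x * q ^ n)" for n
  proof -
    have "?P n > 0" by (intro prod_pos pos)
    then show ?thesis using qprod_split[of n] by (metis less_irrefl nonzero_mult_div_cancel_right)
  qed
  ultimately show ?thesis using qprod_pos by simp
qed

end

text \<open>
  The constants are \<open>a1 = \<alpha> + \<beta>\<close>, \<open>a2 = \<alpha>\<beta>\<close>, \<open>b1 = \<gamma> + \<delta>\<close> and \<open>b2 = \<gamma>\<delta>\<close>. From here on, the index \<open>n\<close>
  refers to configurations of \<open>N = n + 1\<close> points, which turns the shift \<open>q\<^bsup>1-N\<^esup>\<close> into \<open>1 / q\<^sup>n\<close>.
\<close>

locale q_weights = q_lattice +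
  fixes a1 a2 b1 b2 :: real
  assumes a2_pos: "0 < a2" and leading: "a2 < b2 * q"
    and quad_a_pos: "\<And>x. x \<in> L \<Longrightarrow> 0 < quad a1 a2 x"
    and quad_b_pos: "\<And>x. x \<in> L \<Longrightarrow> 0 < quad b1 b2 x"
begin

lemma b2_pos: "0 < b2"
  using a2_pos leading q_pos by (meson less_trans zero_less_mult_pos2)

text \<open>
  The weight without the factor \<open>\<bar>x\<bar>\<close>.
\<close>

definition wratio :: "nat \<Rightarrow> real \<Rightarrow> real" where
  "wratio n x = qprod q a1 a2 x / qprod q b1 b2 (x / q ^ n)"

definition w :: "nat \<Rightarrow> real \<Rightarrow> real" where
  "w n x = \<bar>x\<bar> * wratio n x"

lemma positive_qprod_a: "x \<in> L \<Longrightarrow> positive_qprod q a1 a2 x"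
  by unfold_locales (auto simp: q_pos q_less_1 intro!: quad_a_pos lattice_mult_power)

lemma positive_qprod_b: "x \<in> L \<Longrightarrow> positive_qprod q b1 b2 (x / q ^ n)"
  by unfold_locales
    (auto simp: q_pos q_less_1 intro!: quad_b_pos lattice_mult_power lattice_divide_power
      simp del: times_divide_eq_left)

lemma wratio_pos: "x \<in> L \<Longrightarrow> 0 < wratio n x"
  unfolding wratio_def
  by (intro divide_pos_pos positive_qprod.qprod_pos positive_qprod_a positive_qprod_b)

lemma w_pos: "x \<in> L \<Longrightarrow> 0 < w n x"
  unfolding w_def using wratio_pos lattice_nonzero by simp

text \<open>
  This lemma and the next one express the weight ratio of one level, at a point and at its
  neighbour away from 0, through that of the following level. Together they form the
  \<open>q\<close>-difference equation behind the telescoping.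
\<close>

lemma wratio_eq_quad_b:
  assumes x: "x \<in> L"
  shows "wratio n x = quad b1 b2 (x / q ^ Suc n) * wratio (Suc n) x"
proof -
  interpret positive_qprod q b1 b2 "x / q ^ Suc n" by (rule positive_qprod_b[OF x])
  have "qprod q b1 b2 (x / q ^ Suc n) = quad b1 b2 (x / q ^ Suc n) * qprod q b1 b2 (x / q ^ n)"
    using qprod_step by simp
  moreover have "quad b1 b2 (x / q ^ Suc n) > 0"
    by (rule quad_b_pos[OF lattice_divide_power[OF x]])
  ultimately show ?thesis by (simp add: wratio_def)
qed

lemma wratio_divide_eq_quad_a:
  assumes x: "x \<in> L"
  shows "wratio n (x / q) = quad a1 a2 (x / q) * wratio (Suc n) x"
proof -
  interpret positive_qprod q a1 a2 "x / q" by (rule positive_qprod_a[OF lattice_divide[OF x]])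
  have "qprod q a1 a2 (x / q) = quad a1 a2 (x / q) * qprod q a1 a2 x"
    using qprod_step by simp
  then show ?thesis by (simp add: wratio_def)
qed

lemma wratio_tendsto_at_0:
  assumes "x \<in> L"
  shows "(\<lambda>m. wratio n (x * q ^ m)) \<longlonglongrightarrow> 1"
proof -
  have "(\<lambda>m. wratio n (x * q ^ m)) \<longlonglongrightarrow> 1 / 1"
    unfolding wratio_def times_divide_eq_left[symmetric]
    by (intro tendsto_divide positive_qprod.qprod_tendsto_1 positive_qprod_a positive_qprod_b assms) simp
  then show ?thesis by simp
qed

text \<open>
  Dominates, up to a constant factor, the weight times any polynomial of degree at most
  \<open>2 n\<close>. This is the degree in each variable of the squared Vandermonde product of \<open>n + 1\<close> points.
\<close>

definition envelope :: "nat \<Rightarrow> real \<Rightarrow> real" where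
  "envelope n x = w n x * (1 + \<bar>x\<bar>) ^ (2 * n)"

lemma envelope_pos: "x \<in> L \<Longrightarrow> 0 < envelope n x"
  unfolding envelope_def by (intro mult_pos_pos w_pos zero_less_power) auto

lemma summable_envelope_at_0:
  assumes z: "z \<in> L"
  shows "summable (\<lambda>m. envelope n (z * q ^ m))"
proof -
  have "Bseq (\<lambda>m. wratio n (z * q ^ m))"
    using wratio_tendsto_at_0[OF z] by (intro convergent_imp_Bseq) (auto simp: convergent_def)
  then obtain K where K: "\<And>m. norm (wratio n (z * q ^ m)) \<le> K" by (metis BseqE)
  show ?thesis
  proof (rule summable_comparison_test')
    show "summable (\<lambda>m. (\<bar>z\<bar> * K * (1 + \<bar>z\<bar>) ^ (2 * n)) * q ^ m)"
      using q_pos q_less_1 by (intro summable_mult summable_geometric) simp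
    fix m
    have zm: "z * q ^ m \<in> L" by (rule lattice_mult_power[OF z])
    have abs: "\<bar>z * q ^ m\<bar> = \<bar>z\<bar> * q ^ m" using q_pos by (simp add: abs_mult)
    also have "\<dots> \<le> \<bar>z\<bar>" using q_pos q_less_1 by (intro mult_left_le power_le_one) auto
    finally have le: "\<bar>z * q ^ m\<bar> \<le> \<bar>z\<bar>" .
    have "envelope n (z * q ^ m) = (\<bar>z\<bar> * q ^ m) * wratio n (z * q ^ m) * (1 + \<bar>z * q ^ m\<bar>) ^ (2 * n)"
      by (simp add: envelope_def w_def abs)
    also have "\<dots> \<le> (\<bar>z\<bar> * q ^ m) * K * (1 + \<bar>z\<bar>) ^ (2 * n)"
      using K[of m] less_imp_le[OF wratio_pos[OF zm, of n]] le q_pos by (intro mult_mono power_mono) auto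
    finally show "norm (envelope n (z * q ^ m)) \<le> (\<bar>z\<bar> * K * (1 + \<bar>z\<bar>) ^ (2 * n)) * q ^ m"
      using envelope_pos[OF zm, of n] by (simp add: mult_ac)
  qed
qed

lemma envelope_ratio:
  assumes x: "x \<in> L"
  shows "envelope n (x / q) = envelope n x * (1 / q * ((1 + \<bar>x\<bar> / q) / (1 + \<bar>x\<bar>)) ^ (2 * n) *
    (quad a1 a2 (x / q) / quad b1 b2 (x / q ^ Suc n)))"
proof -
  have "wratio n (x / q) = wratio n x * (quad a1 a2 (x / q) / quad b1 b2 (x / q ^ Suc n))"
    using wratio_eq_quad_b[OF x, of n] wratio_divide_eq_quad_a[OF x, of n]
      quad_b_pos[OF lattice_divide_power[OF x, of "Suc n"]] by simp
  moreover have "1 + \<bar>x\<bar> \<noteq> 0" using abs_ge_zero[of x] by linarith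
  ultimately show ?thesis
    using q_pos by (simp add: envelope_def w_def power_divide)
qed

text \<open>
  Clearing the denominator \<open>t\<close> moves the limit at infinity to a value at \<open>t = 0\<close>.
\<close>

lemma quad_ratio_scaled:
  assumes "t \<noteq> 0"
  shows "quad c1 c2 (y / t) / quad d1 d2 (y' / t) =
    (t ^ 2 - c1 * y * t + c2 * y ^ 2) / (t ^ 2 - d1 * y' * t + d2 * y' ^ 2)"
proof -
  have "quad e1 e2 (u / t) = (t ^ 2 - e1 * u * t + e2 * u ^ 2) / t ^ 2" for e1 e2 u
    using assms by (simp add: quad_def field_simps power2_eq_square)
  then show ?thesis using assms by simp
qed

text \<open>
  One step away from 0 multiplies \<open>\<bar>x\<bar>\<close> by \<open>q\<^bsup>-1\<^esup>\<close>, the polynomial factor by about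
  \<open>q\<^bsup>-2n\<^esup>\<close> and the weight ratio by about \<open>(a2 / b2) q\<^bsup>2n\<^esup>\<close>. The ratio test therefore applies
  precisely when \<open>a2 < b2 * q\<close>.
\<close>

lemma envelope_ratio_limit:
  assumes z: "z \<in> L"
  shows "(\<lambda>m. 1 / q * ((1 + \<bar>z / q ^ m\<bar> / q) / (1 + \<bar>z / q ^ m\<bar>)) ^ (2 * n) *
    (quad a1 a2 (z / q ^ m / q) / quad b1 b2 (z / q ^ m / q ^ Suc n))) \<longlonglongrightarrow> a2 / (b2 * q)"
proof -
  have z0: "z \<noteq> 0" using lattice_nonzero[OF z] .
  \<comment> \<open>Numerator and denominator are multiplied by powers of \<open>t = q\<^sup>m\<close>, so that \<open>t = 0\<close> makes sense.\<close>
  define F where "F t = 1 / q * ((t + \<bar>z\<bar> / q) / (t + \<bar>z\<bar>)) ^ (2 * n) *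
    ((t ^ 2 - a1 * (z / q) * t + a2 * (z / q) ^ 2) /
     (t ^ 2 - b1 * (z / q ^ Suc n) * t + b2 * (z / q ^ Suc n) ^ 2))" for t
  have "(\<lambda>m. q ^ m) \<longlonglongrightarrow> 0" using q_pos q_less_1 by (intro LIMSEQ_power_zero) simp
  moreover have "isCont F 0"
    unfolding F_def using z0 b2_pos by (intro continuous_intros) simp_all
  ultimately have "(\<lambda>m. F (q ^ m)) \<longlonglongrightarrow> F 0"
    using isCont_tendsto_compose[of 0 F] by blast
  also have "F 0 = a2 / (b2 * q)"
  proof -
    have "F 0 = 1 / q * (1 / q) ^ (2 * n) * (a2 * (z / q) ^ 2 / (b2 * (z / q ^ Suc n) ^ 2))"
      using z0 by (simp add: F_def)
    also have "(z / q ^ Suc n) ^ 2 = (z / q) ^ 2 * (1 / q) ^ (2 * n)"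
      by (simp add: power_divide power_mult_distrib power_mult[symmetric] mult.commute)
    also have "1 / q * (1 / q) ^ (2 * n) * (a2 * (z / q) ^ 2 / (b2 * ((z / q) ^ 2 * (1 / q) ^ (2 * n)))) = a2 / (b2 * q)"
      using z0 b2_pos by simp
    finally show ?thesis .
  qed
  also have "(\<lambda>m. F (q ^ m)) = (\<lambda>m. 1 / q * ((1 + \<bar>z / q ^ m\<bar> / q) / (1 + \<bar>z / q ^ m\<bar>)) ^ (2 * n) *
    (quad a1 a2 (z / q ^ m / q) / quad b1 b2 (z / q ^ m / q ^ Suc n)))"
  proof
    fix m
    define t where "t = q ^ m"
    have t: "t > 0" using q_pos by (simp add: t_def)
    have "1 + \<bar>z / t\<bar> / q = (t + \<bar>z\<bar> / q) / t" "1 + \<bar>z / t\<bar> = (t + \<bar>z\<bar>) / t"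
      using t q_pos by (simp_all add: field_simps)
    then have 1: "(1 + \<bar>z / t\<bar> / q) / (1 + \<bar>z / t\<bar>) = (t + \<bar>z\<bar> / q) / (t + \<bar>z\<bar>)" using t by simp
    have "z / t / q = (z / q) / t" "z / t / q ^ Suc n = (z / q ^ Suc n) / t" by (simp_all add: mult_ac)
    then have 2: "quad a1 a2 (z / t / q) / quad b1 b2 (z / t / q ^ Suc n) =
        (t ^ 2 - a1 * (z / q) * t + a2 * (z / q) ^ 2) /
        (t ^ 2 - b1 * (z / q ^ Suc n) * t + b2 * (z / q ^ Suc n) ^ 2)"
      using t by (simp only: quad_ratio_scaled less_imp_neq[OF t, symmetric] not_False_eq_True)
    show "F (q ^ m) = 1 / q * ((1 + \<bar>z / q ^ m\<bar> / q) / (1 + \<bar>z / q ^ m\<bar>)) ^ (2 * n) *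
    (quad a1 a2 (z / q ^ m / q) / quad b1 b2 (z / q ^ m / q ^ Suc n))"
      unfolding t_def[symmetric] 1 2 F_def ..
  qed
  finally show ?thesis .
qed

lemma summable_envelope_at_infinity:
  assumes z: "z \<in> L"
  shows "summable (\<lambda>m. envelope n (z / q ^ m))"
proof -
  let ?r = "\<lambda>m. 1 / q * ((1 + \<bar>z / q ^ m\<bar> / q) / (1 + \<bar>z / q ^ m\<bar>)) ^ (2 * n) *
    (quad a1 a2 (z / q ^ m / q) / quad b1 b2 (z / q ^ m / q ^ Suc n))"
  have "a2 / (b2 * q) < 1" using leading b2_pos q_pos by simp
  then obtain c where c: "a2 / (b2 * q) < c" "c < 1" using dense by blast
  have "eventually (\<lambda>m. ?r m < c) sequentially"
    using order_tendstoD(2)[OF envelope_ratio_limit[OF z] c(1)] .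
  then obtain M where M: "\<And>m. m \<ge> M \<Longrightarrow> ?r m < c" by (auto simp: eventually_sequentially)
  show ?thesis
  proof (rule summable_ratio_test[OF c(2)])
    fix m assume "M \<le> m"
    have zm: "z / q ^ k \<in> L" for k by (rule lattice_divide_power[OF z])
    have "envelope n (z / q ^ Suc m) = envelope n (z / q ^ m / q)" by (simp add: mult.commute)
    also have "\<dots> = envelope n (z / q ^ m) * ?r m" by (rule envelope_ratio[OF zm])
    also have "\<dots> \<le> envelope n (z / q ^ m) * c"
      using M[OF \<open>M \<le> m\<close>] envelope_pos[OF zm, of n m] by (intro mult_left_mono) auto
    finally show "norm (envelope n (z / q ^ Suc m)) \<le> c * norm (envelope n (z / q ^ m))"
      using envelope_pos[OF zm, of n m] envelope_pos[OF zm, of n "Suc m"] by (simp add: mult.commute)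
  qed
qed

lemma lattice_decomposition: "L = {x \<in> L. 0 < x * zm} \<union> {x \<in> L. 0 < x * zp}"
  using lattice_nonzero zm_neg zp_pos by (auto simp: zero_less_mult_iff neq_iff)

lemma summable_envelope: "envelope n summable_on L"
proof -
  have "envelope n summable_on {x \<in> L. 0 < x * z}" if z: "z \<in> L" for z
  proof -
    have "(\<lambda>m. envelope n (z / q ^ m)) summable_on UNIV"
      using summable_envelope_at_infinity[OF z] envelope_pos[OF lattice_divide_power[OF z]]
      by (intro summable_nonneg_imp_summable_on) (auto intro: less_imp_le)
    then have "envelope n summable_on ray_out z"
      using has_sum_ray_out_iff[OF lattice_nonzero[OF z]] by (auto simp: summable_on_def)
    moreover have "(\<lambda>m. envelope n (z * q * q ^ m)) summable_on UNIV"
      using summable_envelope_at_0[OF lattice_mult[OF z]] envelope_pos[OF lattice_mult_power[OF lattice_mult[OF z]]]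
      by (intro summable_nonneg_imp_summable_on) (auto intro: less_imp_le)
    then have "envelope n summable_on ray_in (z * q)"
      using has_sum_ray_in_iff[OF lattice_nonzero[OF lattice_mult[OF z]]] by (auto simp: summable_on_def)
    ultimately show ?thesis
      unfolding ray_out_Un_ray_in(1)[OF z]
      by (intro summable_on_Un_disjoint ray_out_Un_ray_in(2)[OF z])
  qed
  from this[OF zm_in_lattice] this[OF zp_in_lattice]
  have "envelope n summable_on ({x \<in> L. 0 < x * zm} \<union> {x \<in> L. 0 < x * zp})"
    by (rule summable_on_union)
  then show ?thesis by (simp only: lattice_decomposition[symmetric])
qed

lemma power_le_one_plus: "k \<le> l \<Longrightarrow> \<bar>x\<bar> ^ k \<le> (1 + \<bar>x\<bar>) ^ l" for x :: real
  by (rule order_trans[OF power_mono power_increasing]) auto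

lemma summable_w_poly:
  assumes "degree p \<le> 2 * n"
  shows "(\<lambda>x. w n x * poly p x) summable_on L"
proof -
  let ?K = "\<Sum>i\<le>degree p. \<bar>coeff p i\<bar>"
  \<comment> \<open>The triangle inequality for the monomials of the polynomial gives the constant.\<close>
  have "(\<lambda>x. ?K * envelope n x) summable_on L" by (rule summable_on_cmult_right[OF summable_envelope])
  then have "(\<lambda>x. norm (w n x * poly p x)) summable_on L"
  proof (rule Infinite_Sum.abs_summable_on_comparison_test')
    fix x assume x: "x \<in> L"
    have "\<bar>poly p x\<bar> \<le> (\<Sum>i\<le>degree p. \<bar>coeff p i * x ^ i\<bar>)"
      unfolding poly_altdef by (rule sum_abs)
    also have "\<dots> \<le> (\<Sum>i\<le>degree p. \<bar>coeff p i\<bar> * (1 + \<bar>x\<bar>) ^ (2 * n))"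
      unfolding abs_mult power_abs
      by (intro sum_mono mult_left_mono power_le_one_plus) (use assms in auto)
    also have "\<dots> = ?K * (1 + \<bar>x\<bar>) ^ (2 * n)" by (simp add: sum_distrib_right)
    finally have "w n x * \<bar>poly p x\<bar> \<le> w n x * (?K * (1 + \<bar>x\<bar>) ^ (2 * n))"
      using w_pos[OF x, of n] by (intro mult_left_mono) auto
    then show "norm (w n x * poly p x) \<le> ?K * envelope n x"
      using w_pos[OF x, of n] by (simp add: abs_mult envelope_def mult_ac)
  qed
  then show ?thesis by (rule abs_summable_summable)
qed

end

section \<open>Exact differences\<close>

context q_weights
begin

text \<open>
  The expression whose \<open>q\<close>-differences are summed; it occurs as the boundary term of these sums.
\<close>

definition boundary :: "nat \<Rightarrow> nat \<Rightarrow> real \<Rightarrow> real" where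
  "boundary n k x = wratio n x * x ^ k"

text \<open>
  Obtained by dividing \<open>quad b1 b2 (x / q\<^bsup>n+1\<^esup>) x\<^sup>k - quad a1 a2 (x / q) (x / q)\<^sup>k\<close> by \<open>x\<close>. For
  \<open>k = 0\<close> the first summand vanishes, so the truncated exponent \<open>k - 1\<close> is harmless.
\<close>

definition step_poly :: "nat \<Rightarrow> nat \<Rightarrow> real poly" where
  "step_poly n k = monom (1 - 1 / q ^ k) (k - 1) + monom (a1 / q ^ Suc k - b1 / q ^ Suc n) k +
     monom (b2 / q ^ (2 * Suc n) - a2 / q ^ (k + 2)) (Suc k)"

lemma degree_step_poly: "degree (step_poly n k) \<le> Suc k"
  unfolding step_poly_def by (intro degree_add_le order_trans[OF degree_monom_le]) auto

text \<open>
  The bound on \<open>k\<close> ensures \<open>q\<^bsup>2n\<^esup> \<le> q\<^sup>k\<close>, and \<open>a2 < b2\<close> then decides the sign.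
\<close>

lemma lead_step_poly_pos:
  assumes "k \<le> n"
  shows "0 < coeff (step_poly n k) (Suc k)"
proof -
  have "a2 * q ^ (2 * Suc n) < b2 * q ^ (k + 2)"
  proof (rule mult_less_le_imp_less)
    have "b2 * q \<le> b2 * 1" using b2_pos q_less_1 by (intro mult_left_mono) auto
    then show "a2 < b2" using leading by simp
    show "q ^ (2 * Suc n) \<le> q ^ (k + 2)"
      using assms q_pos q_less_1 by (intro power_decreasing) auto
  qed (use a2_pos q_pos in auto)
  then have "a2 / q ^ (k + 2) < b2 / q ^ (2 * Suc n)"
    using q_pos by (simp add: divide_less_eq less_divide_eq mult.commute del: power_Suc)
  moreover have "k - 1 \<noteq> Suc k" by linarith
  ultimately show ?thesis by (simp add: step_poly_def)
qed

text \<open>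
  By the two relations between consecutive levels, both boundary values on the right are
  multiples of the weight ratio of level \<open>n + 1\<close> at \<open>x\<close>.
\<close>

lemma telescoping:
  assumes x: "x \<in> L"
  shows "w (Suc n) x * poly (step_poly n k) x = sgn x * (boundary n k x - boundary n k (x / q))"
proof -
  have poly: "x * poly (step_poly n k) x = quad b1 b2 (x / q ^ Suc n) * x ^ k - quad a1 a2 (x / q) * (x / q) ^ k"
  proof -
    have "x * poly (step_poly n k) x = (1 - 1 / q ^ k) * (x * x ^ (k - 1)) +
        (a1 / q ^ Suc k - b1 / q ^ Suc n) * x ^ Suc k + (b2 / q ^ (2 * Suc n) - a2 / q ^ (k + 2)) * x ^ (k + 2)"
      by (simp add: step_poly_def poly_monom algebra_simps)
    also have "(1 - 1 / q ^ k) * (x * x ^ (k - 1)) = (1 - 1 / q ^ k) * x ^ k"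
      by (cases k) auto
    also have "(1 - 1 / q ^ k) * x ^ k + (a1 / q ^ Suc k - b1 / q ^ Suc n) * x ^ Suc k +
        (b2 / q ^ (2 * Suc n) - a2 / q ^ (k + 2)) * x ^ (k + 2) =
        (1 - b1 * (x / q ^ Suc n) + b2 * (x ^ 2 / q ^ (2 * Suc n))) * x ^ k -
        (1 - a1 * (x / q) + a2 * (x ^ 2 / q ^ 2)) * (x ^ k / q ^ k)"
    proof -
      have "(1 - 1 / Q) * u + (a1 / (q * Q) - b1 / P) * (x * u) + (b2 / P' - a2 / (Q * q ^ 2)) * (u * x ^ 2) =
          (1 - b1 * (x / P) + b2 * (x ^ 2 / P')) * u - (1 - a1 * (x / q) + a2 * (x ^ 2 / q ^ 2)) * (u / Q)"
        for Q u P P' :: real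
        by (simp add: divide_inverse algebra_simps)
      from this[of "q ^ k" "x ^ k" "q ^ Suc n" "q ^ (2 * Suc n)"] show ?thesis
        by (simp only: power_Suc[of q k] power_Suc[of x k] power_add[of q k 2] power_add[of x k 2])
    qed
    also have "x ^ 2 / q ^ (2 * Suc n) = (x / q ^ Suc n) ^ 2"
      by (simp only: power_divide power_mult[symmetric] mult.commute[of "Suc n" 2])
    finally show ?thesis by (simp add: quad_def power_divide)
  qed
  have "w (Suc n) x * poly (step_poly n k) x = sgn x * wratio (Suc n) x * (x * poly (step_poly n k) x)"
    by (simp add: w_def abs_sgn mult_ac)
  also have "\<dots> = sgn x * (boundary n k x - boundary n k (x / q))"
    unfolding poly boundary_def wratio_eq_quad_b[OF x, of n] wratio_divide_eq_quad_a[OF x, of n]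
    by (simp add: algebra_simps)
  finally show ?thesis .
qed

lemma summable_telescoping:
  assumes "k \<le> n" "A \<subseteq> L"
  shows "(\<lambda>x. w (Suc n) x * poly (step_poly n k) x) summable_on A"
  by (rule summable_on_subset[OF summable_w_poly])
    (use degree_step_poly[of n k] assms in auto)

text \<open>
  The boundary term is dominated by the summable envelope, which has an additional factor \<open>\<bar>x\<bar>\<close>.
\<close>

lemma boundary_tendsto_at_infinity:
  assumes z: "z \<in> L" and k: "k \<le> n"
  shows "(\<lambda>m. boundary n k (z / q ^ m)) \<longlonglongrightarrow> 0"
proof (rule Lim_null_comparison)
  have "(\<lambda>m. envelope n (z / q ^ m) / \<bar>z\<bar>) \<longlonglongrightarrow> 0 / \<bar>z\<bar>"
    using lattice_nonzero[OF z]
    by (intro tendsto_divide tendsto_const summable_LIMSEQ_zero summable_envelope_at_infinity z) auto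
  then show "(\<lambda>m. envelope n (z / q ^ m) / \<bar>z\<bar>) \<longlonglongrightarrow> 0" by simp
  show "eventually (\<lambda>m. norm (boundary n k (z / q ^ m)) \<le> envelope n (z / q ^ m) / \<bar>z\<bar>) sequentially"
  proof (intro always_eventually allI)
    fix m
    define x where "x = z / q ^ m"
    have xL: "x \<in> L" unfolding x_def by (rule lattice_divide_power[OF z])
    have "x \<in> ray_out z" by (auto simp: x_def ray_out_def)
    then have zx: "\<bar>z\<bar> \<le> \<bar>x\<bar>" using z by (simp add: ray_out_eq)
    have "norm (boundary n k x) * \<bar>z\<bar> = \<bar>z\<bar> * wratio n x * \<bar>x\<bar> ^ k"
      using wratio_pos[OF xL, of n] by (simp add: boundary_def abs_mult power_abs)
    also have "\<dots> \<le> \<bar>x\<bar> * wratio n x * (1 + \<bar>x\<bar>) ^ (2 * n)"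
      using less_imp_le[OF wratio_pos[OF xL, of n]] zx k
      by (intro mult_mono power_le_one_plus mult_right_mono) auto
    also have "\<dots> = envelope n x" by (simp add: envelope_def w_def)
    finally show "norm (boundary n k (z / q ^ m)) \<le> envelope n (z / q ^ m) / \<bar>z\<bar>"
      using lattice_nonzero[OF z] unfolding x_def by (simp add: field_simps)
  qed
qed

lemma has_sum_ray_out:
  assumes b: "b \<in> L" and k: "k \<le> n"
  shows "((\<lambda>x. w (Suc n) x * poly (step_poly n k) x) has_sum sgn b * boundary n k b) (ray_out b)"
proof -
  let ?f = "\<lambda>x. w (Suc n) x * poly (step_poly n k) x"
  have b0: "b \<noteq> 0" using lattice_nonzero[OF b] .
  obtain s where s: "(?f has_sum s) (ray_out b)"
    using summable_telescoping[OF k ray_out_subset[OF b]] by (auto simp: summable_on_def)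
  then have "(\<lambda>m. ?f (b / q ^ m)) sums s"
    using has_sum_imp_sums has_sum_ray_out_iff[OF b0] by blast
  moreover have "(\<lambda>m. sgn b * (boundary n k (b / q ^ m) - boundary n k (b / q ^ Suc m))) sums (sgn b * (boundary n k (b / q ^ 0) - 0))"
    by (intro sums_mult telescope_sums' boundary_tendsto_at_infinity[OF b k])
  moreover have "?f (b / q ^ m) = sgn b * (boundary n k (b / q ^ m) - boundary n k (b / q ^ Suc m))" for m
  proof -
    have "sgn (b / q ^ m) = sgn b" using q_pos by (simp add: sgn_divide)
    moreover have "b / q ^ m / q = b / q ^ Suc m" by simp
    ultimately show ?thesis using telescoping[OF lattice_divide_power[OF b], of n m k] by (simp only:)
  qed
  ultimately have "s = sgn b * boundary n k b" using sums_unique2 by fastforce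
  with s show ?thesis by simp
qed

text \<open>
  At 0 the boundary term tends to \<open>0\<^sup>k\<close>, which is 1 for \<open>k = 0\<close>.
\<close>

lemma has_sum_ray_in:
  assumes b: "b \<in> L" and k: "k \<le> n"
  shows "((\<lambda>x. w (Suc n) x * poly (step_poly n k) x) has_sum sgn b * (0 ^ k - boundary n k b)) (ray_in (b * q))"
proof -
  let ?f = "\<lambda>x. w (Suc n) x * poly (step_poly n k) x"
  have bq0: "b * q \<noteq> 0" using lattice_nonzero[OF b] by simp
  obtain s where s: "(?f has_sum s) (ray_in (b * q))"
    using summable_telescoping[OF k ray_in_subset[OF lattice_mult[OF b]]] by (auto simp: summable_on_def)
  then have "(\<lambda>m. ?f (b * q * q ^ m)) sums s"
    using has_sum_imp_sums has_sum_ray_in_iff[OF bq0] by blast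
  moreover have "(\<lambda>m. q ^ m) \<longlonglongrightarrow> 0" using q_pos q_less_1 by (intro LIMSEQ_power_zero) simp
  then have "(\<lambda>m. boundary n k (b * q ^ m)) \<longlonglongrightarrow> 1 * (b * 0) ^ k"
    unfolding boundary_def by (intro tendsto_mult tendsto_power tendsto_const wratio_tendsto_at_0[OF b])
  then have "(\<lambda>m. boundary n k (b * q ^ m)) \<longlonglongrightarrow> 0 ^ k" by simp
  then have "(\<lambda>m. sgn b * (boundary n k (b * q ^ Suc m) - boundary n k (b * q ^ m))) sums (sgn b * (0 ^ k - boundary n k (b * q ^ 0)))"
    by (intro sums_mult telescope_sums)
  moreover have "?f (b * q * q ^ m) = sgn b * (boundary n k (b * q ^ Suc m) - boundary n k (b * q ^ m))" for m
  proof -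
    have "sgn (b * q ^ Suc m) = sgn b" using q_pos by (simp add: sgn_mult)
    moreover have "b * q ^ Suc m / q = b * q ^ m" "b * q * q ^ m = b * q ^ Suc m" by simp_all
    ultimately show ?thesis using telescoping[OF lattice_mult_power[OF b], of n "Suc m" k] by (simp only:)
  qed
  ultimately have "s = sgn b * (0 ^ k - boundary n k b)" using sums_unique2 by fastforce
  with s show ?thesis by simp
qed

text \<open>
  The limits at 0 from the two sides cancel because the factor \<open>sgn x\<close> has opposite signs.
\<close>

lemma has_sum_lattice:
  assumes k: "k \<le> n"
  shows "((\<lambda>x. w (Suc n) x * poly (step_poly n k) x) has_sum 0) L"
proof -
  have half: "((\<lambda>x. w (Suc n) x * poly (step_poly n k) x) has_sum sgn b * 0 ^ k) {x \<in> L. 0 < x * b}"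
    if b: "b \<in> L" for b
    using has_sum_Un_disjoint[OF has_sum_ray_out[OF b k] has_sum_ray_in[OF b k] ray_out_Un_ray_in(2)[OF b]]
    by (simp add: ray_out_Un_ray_in(1)[OF b] algebra_simps)
  have "{x \<in> L. 0 < x * zm} \<inter> {x \<in> L. 0 < x * zp} = {}"
    using zm_neg zp_pos by (auto simp: zero_less_mult_iff)
  from has_sum_Un_disjoint[OF half[OF zm_in_lattice] half[OF zp_in_lattice] this]
  show ?thesis using zm_neg zp_pos by (simp flip: lattice_decomposition)
qed

section \<open>The cells cut out by a configuration\<close>

text \<open>
  Says on which side of the cut at \<open>b\<close> the point \<open>x\<close> lies. The convention for \<open>x = b\<close> depends on
  the sign and is forced by the asymmetry of the interlacing intervals.
\<close>

definition precedes :: "real \<Rightarrow> real \<Rightarrow> bool" where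
  "precedes x b \<longleftrightarrow> (if x < 0 then x \<le> b else x < b)"

definition down :: "real \<Rightarrow> real set" where
  "down b = {x \<in> L. precedes x b}"

text \<open>
  For negative \<open>b\<close> the down-set is a ray towards infinity, for positive \<open>b\<close> it is the complement
  of one. The two cases differ in the sign of \<open>b\<close> as well, so the result has one form.
\<close>

lemma has_sum_down:
  assumes b: "b \<in> L" and k: "k \<le> n"
  shows "((\<lambda>x. w (Suc n) x * poly (step_poly n k) x) has_sum - boundary n k b) (down b)"
proof (cases "b < 0")
  case True
  then have "down b = ray_out b"
    by (auto simp: down_def precedes_def ray_out_eq[OF b] zero_less_mult_iff)
  then show ?thesis using has_sum_ray_out[OF b k] True by simp
next
  case False
  then have b0: "0 < b" using lattice_nonzero[OF b] by simp
  then have "down b = L - ray_out b"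
    using lattice_nonzero by (auto simp: down_def precedes_def ray_out_eq[OF b] zero_less_mult_iff neq_iff)
  then show ?thesis
    using has_sum_Diff[OF has_sum_lattice[OF k] has_sum_ray_out[OF b k] ray_out_subset[OF b]] b0 by simp
qed

text \<open>
  There is no cut after the last point of \<open>Y\<close>, so the last of these sets is the whole lattice.
\<close>

definition initial :: "nat \<Rightarrow> real set \<Rightarrow> nat \<Rightarrow> real set" where
  "initial N Y i = (if i < N then down (point Y i) else L)"

definition cell :: "nat \<Rightarrow> real set \<Rightarrow> nat \<Rightarrow> real set" where
  "cell N Y i = (case i of 0 \<Rightarrow> initial N Y 0 | Suc i' \<Rightarrow> initial N Y i - initial N Y i')"

lemma initial_subset: "initial N Y i \<subseteq> L"
  by (auto simp: initial_def down_def)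

lemma cell_subset: "cell N Y i \<subseteq> L"
  using initial_subset[of N Y] by (auto simp: cell_def split: nat.splits)

lemma initial_mono:
  assumes Y: "Y \<in> C N" and "i < N"
  shows "initial N Y i \<subseteq> initial N Y (Suc i)"
proof (cases "Suc i < N")
  case True
  have "point Y i < point Y (Suc i)"
    using configsD[OF Y] True by (intro point_strict_mono) auto
  then show ?thesis using True by (auto simp: initial_def down_def precedes_def)
qed (use assms in \<open>auto simp: initial_def down_def\<close>)

lemma cell_ordered:
  assumes "Suc i < Suc N" "x \<in> cell N Y i" "y \<in> cell N Y (Suc i)"
  shows "x < y"
  using assms by (auto simp: cell_def initial_def down_def precedes_def split: nat.splits if_splits)

text \<open>
  Interlacing says that the cut at the \<open>i\<close>-th point of \<open>Y\<close> separates the points \<open>i\<close> and \<open>i + 1\<close>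
  of \<open>X\<close>; collecting the two conditions on each point of \<open>X\<close> places it in a cell.
\<close>

lemma interlaces_iff_chamber:
  assumes X: "X \<in> C (Suc N)" and Y: "Y \<in> C N"
  shows "interlaces q zm zp N Y X \<longleftrightarrow> X \<in> chamber (Suc N) (cell N Y)"
proof -
  let ?x = "point X" and ?y = "point Y"
  have xL: "?x i \<in> L" if "i \<le> N" for i using configsD[OF X] that by auto
  have yL: "?y i \<in> L" if "i < N" for i using configsD[OF Y] that by auto
  have step: "?y i \<in> I (?x i) (?x (Suc i)) \<longleftrightarrow> precedes (?x i) (?y i) \<and> \<not> precedes (?x (Suc i)) (?y i)"
    if "i < N" for i
  proof -
    have "?x i < ?x (Suc i)" using configsD[OF X] that by (intro point_strict_mono) auto
    then show ?thesis
      using yL[OF that] xL[of i] xL[of "Suc i"] lattice_nonzero[of "?x i"] lattice_nonzero[of "?x (Suc i)"] that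
      by (auto simp: interlacing_interval_def precedes_def)
  qed
  have "X \<in> chamber (Suc N) (cell N Y) \<longleftrightarrow> (\<forall>i<Suc N. ?x i \<in> cell N Y i)"
    using configsD[OF X] by (simp add: chamber_def)
  also have "\<dots> \<longleftrightarrow> (\<forall>i<Suc N. (i < N \<longrightarrow> precedes (?x i) (?y i)) \<and> (\<forall>i'. i = Suc i' \<longrightarrow> \<not> precedes (?x i) (?y i')))"
  proof (intro all_cong1 imp_cong refl)
    fix i assume "i < Suc N"
    then show "?x i \<in> cell N Y i \<longleftrightarrow>
        (i < N \<longrightarrow> precedes (?x i) (?y i)) \<and> (\<forall>i'. i = Suc i' \<longrightarrow> \<not> precedes (?x i) (?y i'))"
      using xL[of i] by (auto simp: cell_def initial_def down_def split: nat.splits)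
  qed
  also have "\<dots> \<longleftrightarrow> (\<forall>i<N. precedes (?x i) (?y i) \<and> \<not> precedes (?x (Suc i)) (?y i))" (is "?l \<longleftrightarrow> ?r")
  proof
    assume l: ?l
    show ?r
    proof (intro allI impI)
      fix i assume "i < N"
      then show "precedes (?x i) (?y i) \<and> \<not> precedes (?x (Suc i)) (?y i)"
        using spec[OF l, of i] spec[OF l, of "Suc i"] by auto
    qed
  qed auto
  also have "\<dots> \<longleftrightarrow> interlaces q zm zp N Y X"
    using step by (auto simp: interlaces_def)
  finally show ?thesis by simp
qed

text \<open>
  The constant in \<open>interlacing_sum\<close>: the only entry of the expanded row, corrected by the leading
  coefficients of the polynomials in the determinant.
\<close>

definition cell_const :: "nat \<Rightarrow> real" where
  "cell_const n = (\<Sum>\<^sub>\<infinity>x\<in>L. w (Suc n) x) / (\<Prod>k<Suc n. coeff (step_poly n k) (Suc k))"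

text \<open>
  The core of the proof. Summing rows replaces cells by initial sets, whose sums are boundary
  values. The last row then has the single nonzero entry \<open>S\<close>, the sum of the weight over the
  lattice, and the remaining minor is a Vandermonde determinant with scaled rows. The sign of the
  expansion cancels against the signs of the boundary values.
\<close>

lemma interlacing_sum:
  assumes Y: "Y \<in> C (Suc n)"
  shows "((\<lambda>X. (\<Prod>x\<in>X. w (Suc n) x) * vandermonde X) has_sum
      cell_const n * (\<Prod>y\<in>Y. wratio n y) * vandermonde Y) (chamber (Suc (Suc n)) (cell (Suc n) Y))"
proof -
  let ?N = "Suc n"
  note Yp = configsD[OF Y]
  define p where "p j = (case j of 0 \<Rightarrow> 1 | Suc k \<Rightarrow> step_poly n k)" for j
  define S where "S = (\<Sum>\<^sub>\<infinity>x\<in>L. w (Suc n) x)"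
  \<comment> \<open>The first \<open>i + 1\<close> cells together form the \<open>i\<close>-th initial set, so these are the entries after summation of rows.\<close>
  define T where "T i j = (\<Sum>\<^sub>\<infinity>x\<in>initial ?N Y i. w (Suc n) x * poly (p j) x)" for i j
  define lead where "lead = (\<Prod>k<?N. coeff (step_poly n k) (Suc k))"
  have lead: "(\<Prod>j<Suc ?N. coeff (p j) j) = lead"
    unfolding prod.lessThan_Suc_shift[of _ ?N] lead_def by (simp add: p_def)
  have lead_pos: "0 < lead" unfolding lead_def by (intro prod_pos ballI lead_step_poly_pos) auto
  have deg: "degree (p j) \<le> j" for j
    using degree_step_poly by (auto simp: p_def split: nat.splits)
  have summable: "(\<lambda>x. w (Suc n) x * poly (p j) x) summable_on A" if "j < Suc ?N" "A \<subseteq> L" for j A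
    by (rule summable_on_subset[OF summable_w_poly])
      (use deg[of j] that in auto)
  have cells: "(\<Sum>\<^sub>\<infinity>x\<in>cell ?N Y i. w (Suc n) x * poly (p j) x) = (case i of 0 \<Rightarrow> T 0 j | Suc i' \<Rightarrow> T i j - T i' j)"
    if "i < Suc ?N" "j < Suc ?N" for i j
  proof (cases i)
    case (Suc i')
    then show ?thesis unfolding T_def cell_def using that
      by (simp add: infsum_Diff summable initial_subset initial_mono[OF Y])
  qed (simp add: cell_def T_def)
  have T0: "T ?N 0 = S" by (simp add: T_def S_def p_def initial_def)
  have T1: "T ?N (Suc k) = 0" if "k \<le> n" for k
    using infsumI[OF has_sum_lattice[OF that]] by (simp add: T_def p_def initial_def)
  have T2: "T i (Suc k) = (- 1) * wratio n (point Y i) * poly (monom 1 k) (point Y i)" if "i < ?N" "k \<le> n" for i k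
    using infsumI[OF has_sum_down[OF Yp(4)[OF that(1)] that(2)]] that
    by (simp add: T_def p_def initial_def boundary_def poly_monom)
  have "detf (Suc ?N) (\<lambda>i j. \<Sum>\<^sub>\<infinity>x\<in>cell ?N Y i. w (Suc n) x * poly (p j) x) =
      detf (Suc ?N) (\<lambda>i j. case i of 0 \<Rightarrow> T 0 j | Suc i' \<Rightarrow> T i j - T i' j)"
    by (rule detf_cong) (rule cells)
  also have "\<dots> = detf (Suc ?N) (\<lambda>i j. \<Sum>l\<le>i. case l of 0 \<Rightarrow> T 0 j | Suc l' \<Rightarrow> T l j - T l' j)"
    by (rule detf_partial_sums[symmetric])
  also have "\<dots> = detf (Suc ?N) T"
    by (rule detf_cong) (rule partial_sums_of_differences)
  also have "\<dots> = (- 1) ^ ?N * T ?N 0 * detf ?N (\<lambda>i j. T i (Suc j))"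
  proof (rule detf_last_row_unit)
    fix j assume "0 < j" "j < Suc ?N"
    then show "T ?N j = 0" using T1[of "j - 1"] by simp
  qed
  also have "detf ?N (\<lambda>i j. T i (Suc j)) =
      detf ?N (\<lambda>i j. (- 1) * wratio n (point Y i) * poly (monom 1 j) (point Y i))"
    by (rule detf_cong) (simp add: T2)
  also have "\<dots> = (\<Prod>i<?N. (- 1) * wratio n (point Y i)) * vandermonde_seq ?N (point Y)"
    by (subst detf_scale_rows, subst detf_poly) (auto simp: degree_monom_le)
  also have "(\<Prod>i<?N. (- 1) * wratio n (point Y i)) = (- 1) ^ ?N * (\<Prod>i<card Y. wratio n (point Y i))"
    unfolding prod.distrib Yp(2) by simp
  also have "(\<Prod>i<card Y. wratio n (point Y i)) = (\<Prod>y\<in>Y. wratio n y)" by (rule prod_point[OF Yp(1)])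
  also have "vandermonde_seq ?N (point Y) = vandermonde Y" by (simp only: vandermonde_eq_seq Yp(2))
  also have "(- 1) ^ ?N * T ?N 0 * ((- 1) ^ ?N * (\<Prod>y\<in>Y. wratio n y) * vandermonde Y) =
      ((- 1) ^ ?N * (- 1) ^ ?N) * (S * (\<Prod>y\<in>Y. wratio n y) * vandermonde Y)"
    unfolding T0 by (simp only: mult_ac)
  also have "(- 1) ^ ?N * (- 1 :: real) ^ ?N = 1" by (simp flip: power_mult_distrib)
  finally have det: "detf (Suc ?N) (\<lambda>i j. \<Sum>\<^sub>\<infinity>x\<in>cell ?N Y i. w (Suc n) x * poly (p j) x) =
      S * (\<Prod>y\<in>Y. wratio n y) * vandermonde Y" by simp
  have "((\<lambda>X. (\<Prod>x\<in>X. w (Suc n) x) * vandermonde X * (\<Prod>j<Suc ?N. coeff (p j) j)) has_sum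
      S * (\<Prod>y\<in>Y. wratio n y) * vandermonde Y) (chamber (Suc ?N) (cell ?N Y))"
    unfolding det[symmetric]
  proof (rule chamber_sum)
    show "x < y" if "Suc i < Suc ?N" "x \<in> cell ?N Y i" "y \<in> cell ?N Y (Suc i)" for i x y
      using cell_ordered that .
    show "countable (cell ?N Y i)" for i
      by (rule countable_subset[OF cell_subset countable_lattice])
    show "degree (p j) \<le> j" for j by (rule deg)
    show "(\<lambda>x. w (Suc n) x * poly (p j) x) summable_on cell ?N Y i" if "j < Suc ?N" for i j
      by (rule summable[OF that cell_subset])
  qed
  moreover have "cell_const n = S / lead" by (simp only: cell_const_def S_def lead_def)
  ultimately show ?thesis
    using has_sum_cmult_left[of _ _ _ "1 / lead"] lead_pos unfolding lead by (fastforce simp: mult_ac)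
qed

section \<open>Partition functions and coherence\<close>

definition real_mass :: "nat \<Rightarrow> real set \<Rightarrow> real" where
  "real_mass n X = (\<Prod>x\<in>X. w n x) * vandermonde X ^ 2"

definition real_partition :: "nat \<Rightarrow> real" where
  "real_partition n = (\<Sum>\<^sub>\<infinity>X\<in>C (Suc n). real_mass n X)"

text \<open>
  Turns out to be the quotient of two consecutive partition functions.
\<close>

definition part_ratio :: "nat \<Rightarrow> real" where
  "part_ratio n = (\<Prod>k=1..Suc n. 1 - q ^ k) * cell_const n"

lemma real_mass_pos: "X \<in> C N \<Longrightarrow> 0 < real_mass n X"
  unfolding real_mass_def using configsD[of X N]
  by (intro mult_pos_pos prod_pos zero_less_power vandermonde_pos ballI w_pos) auto

lemma real_mass_qlink:
  assumes Y: "Y \<in> C (Suc n)"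
  shows "((\<lambda>X. real_mass (Suc n) X * qlink q zm zp (Suc n) X Y) has_sum part_ratio n * real_mass n Y) (C (Suc (Suc n)))"
proof -
  let ?N = "Suc n"
  define K where "K = (\<Prod>y\<in>Y. \<bar>y\<bar>) * (\<Prod>k=1..?N. 1 - q ^ k) * vandermonde Y"
  have "((\<lambda>X. K * ((\<Prod>x\<in>X. w (Suc n) x) * vandermonde X)) has_sum
      K * (cell_const n * (\<Prod>y\<in>Y. wratio n y) * vandermonde Y)) (chamber (Suc ?N) (cell ?N Y))"
    by (rule has_sum_cmult_right[OF interlacing_sum[OF Y]])
  also have "K * (cell_const n * (\<Prod>y\<in>Y. wratio n y) * vandermonde Y) = part_ratio n * real_mass n Y"
    by (simp add: K_def part_ratio_def real_mass_def w_def prod.distrib power2_eq_square mult_ac)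
  also have "((\<lambda>X. K * ((\<Prod>x\<in>X. w (Suc n) x) * vandermonde X)) has_sum part_ratio n * real_mass n Y)
      (chamber (Suc ?N) (cell ?N Y)) \<longleftrightarrow> ?thesis"
  proof (rule has_sum_cong_neutral)
    fix X assume "X \<in> C (Suc ?N) - chamber (Suc ?N) (cell ?N Y)"
    then show "real_mass (Suc n) X * qlink q zm zp ?N X Y = 0"
      using interlaces_iff_chamber[of X ?N Y] Y by (simp add: qlink_def)
  next
    fix X assume "X \<in> chamber (Suc ?N) (cell ?N Y) - C (Suc ?N)"
    then show "K * ((\<Prod>x\<in>X. w (Suc n) x) * vandermonde X) = 0"
      using chamber_subset_configs[of "Suc ?N" "cell ?N Y", OF cell_subset] by auto
  next
    fix X assume X: "X \<in> chamber (Suc ?N) (cell ?N Y) \<inter> C (Suc ?N)"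
    then have "vandermonde X > 0" using configsD[of X] by (intro vandermonde_pos) auto
    then show "K * ((\<Prod>x\<in>X. w (Suc n) x) * vandermonde X) = real_mass (Suc n) X * qlink q zm zp ?N X Y"
      using interlaces_iff_chamber[of X ?N Y] X Y
      by (simp add: qlink_def real_mass_def K_def power2_eq_square mult_ac)
  qed
  finally show ?thesis .
qed

text \<open>
  The mass of a configuration is at most the product of the envelopes of its points, and such
  products are summable over all tuples of lattice points.
\<close>

lemma real_mass_summable: "real_mass n summable_on C (Suc n)"
proof -
  let ?N = "Suc n"
  \<comment> \<open>Listing the points in increasing order embeds the configurations into the tuples.\<close>
  let ?\<phi> = "\<lambda>X. restrict (point X) {..<?N}"
  let ?H = "\<lambda>g. \<Prod>i<?N. envelope n (g i)"
  have "Infinite_Sum.abs_summable_on ?H (PiE {..<?N} (\<lambda>_. L))"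
    unfolding abs_summable_equivalent
    by (rule abs_summable_on_prod_PiE)
      (use summable_envelope[THEN summable_on_iff_abs_summable_on_real[THEN iffD1]] countable_lattice
        in \<open>simp_all flip: abs_summable_equivalent\<close>)
  then have "?H summable_on (PiE {..<?N} (\<lambda>_. L))" by (rule abs_summable_summable)
  then have "?H summable_on (?\<phi> ` C ?N)"
    by (rule summable_on_subset) (use configsD in \<open>auto intro!: restrict_PiE_iff[THEN iffD2]\<close>)
  moreover have "inj_on ?\<phi> (C ?N)"
  proof (rule inj_on_inverseI)
    fix X assume "X \<in> C ?N"
    then show "?\<phi> X ` {..<?N} = X" using point_surj[of X] configsD[of X ?N] by simp
  qed
  ultimately have "(?H \<circ> ?\<phi>) summable_on C ?N"
    by (simp only: summable_on_reindex)
  then have "(\<lambda>X. norm (real_mass n X)) summable_on C ?N"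
  proof (rule Infinite_Sum.abs_summable_on_comparison_test')
    fix X assume X: "X \<in> C ?N"
    note Xp = configsD[OF X]
    have "(?H \<circ> ?\<phi>) X = (\<Prod>i<card X. envelope n (point X i))" by (simp add: Xp(2))
    also have "\<dots> = (\<Prod>x\<in>X. envelope n x)" by (rule prod_point[OF Xp(1)])
    also have "\<dots> = (\<Prod>x\<in>X. w n x) * (\<Prod>x\<in>X. (1 + \<bar>x\<bar>) ^ n) ^ 2"
      by (simp add: envelope_def prod.distrib prod_power_distrib mult.commute flip: power_mult)
    finally have H: "(?H \<circ> ?\<phi>) X = (\<Prod>x\<in>X. w n x) * (\<Prod>x\<in>X. (1 + \<bar>x\<bar>) ^ n) ^ 2" .
    have "0 \<le> (\<Prod>x\<in>X. w n x)" using Xp(3) w_pos by (intro prod_nonneg) (auto intro: less_imp_le)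
    moreover have "vandermonde X ^ 2 \<le> (\<Prod>x\<in>X. (1 + \<bar>x\<bar>) ^ n) ^ 2"
      using vandermonde_le[OF Xp(1,2)] vandermonde_pos[OF Xp(1)] by (intro power_mono) auto
    ultimately have "real_mass n X \<le> (?H \<circ> ?\<phi>) X" unfolding H real_mass_def by (rule mult_left_mono[rotated])
    then show "norm (real_mass n X) \<le> (?H \<circ> ?\<phi>) X" using real_mass_pos[OF X, of n] by simp
  qed
  then show ?thesis by (rule abs_summable_summable)
qed

lemma configs_nonempty: "C N \<noteq> {}"
proof -
  have "inj (\<lambda>m::nat. zp * q ^ m)"
    using zp_pos q_pos q_less_1 by (auto intro!: injI simp: power_inject_exp')
  then have "infinite (ray_in zp)" unfolding ray_in_def by (rule range_inj_infinite)
  then have "infinite L" using ray_in_subset[OF zp_in_lattice] finite_subset by blast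
  then obtain X where "finite X" "card X = N" "X \<subseteq> L" using infinite_arbitrarily_large by metis
  then show ?thesis by (auto simp: configs_def)
qed

lemma real_partition_pos: "0 < real_partition n"
proof -
  obtain X where X: "X \<in> C (Suc n)" using configs_nonempty by blast
  have "sum (real_mass n) {X} \<le> real_partition n"
    unfolding real_partition_def
    by (rule finite_sum_le_infsum[OF real_mass_summable]) (use X real_mass_pos in \<open>auto intro: less_imp_le\<close>)
  then show ?thesis using real_mass_pos[OF X, of n] by simp
qed

lemma qlink_nonneg:
  assumes "X \<in> C M" "Y \<in> C N"
  shows "0 \<le> qlink q zm zp N X Y"
proof -
  have "0 < vandermonde X" "0 < vandermonde Y"
    using assms by (auto simp: configs_def intro: vandermonde_pos)
  moreover have "0 \<le> (\<Prod>k=1..N. 1 - q ^ k)"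
    using q_pos q_less_1 by (intro prod_nonneg) (auto intro: power_le_one)
  ultimately show ?thesis by (simp add: qlink_def prod_nonneg)
qed

text \<open>
  Evaluates the double sum of mass times link in both orders: the rows of the link sum to 1,
  the columns are given by \<open>real_mass_qlink\<close>. All terms are nonnegative.
\<close>

lemma real_partition_Suc: "real_partition (Suc n) = part_ratio n * real_partition n"
proof -
  let ?F = "\<lambda>(X, Y). real_mass (Suc n) X * qlink q zm zp (Suc n) X Y"
  have row: "((\<lambda>Y. ?F (X, Y)) has_sum real_mass (Suc n) X) (C (Suc n))" if "X \<in> C (Suc (Suc n))" for X
    using has_sum_cmult_right[OF qlink_stochastic[OF that], of "real_mass (Suc n) X"] by simp
  have "?F summable_on (C (Suc (Suc n)) \<times> C (Suc n))"
    by (rule summable_on_SigmaI[OF row real_mass_summable])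
      (auto intro!: mult_nonneg_nonneg qlink_nonneg less_imp_le[OF real_mass_pos])
  moreover have "(real_mass (Suc n) has_sum real_partition (Suc n)) (C (Suc (Suc n)))"
    unfolding real_partition_def by (rule has_sum_infsum[OF real_mass_summable])
  ultimately have "(?F has_sum real_partition (Suc n)) (C (Suc (Suc n)) \<times> C (Suc n))"
    by (intro has_sum_SigmaI[OF row])
  then have "((\<lambda>(Y, X). ?F (X, Y)) has_sum real_partition (Suc n)) (C (Suc n) \<times> C (Suc (Suc n)))"
    by (rule has_sum_swap[THEN iffD1])
  then have "((\<lambda>Y. part_ratio n * real_mass n Y) has_sum real_partition (Suc n)) (C (Suc n))"
    by (rule has_sum_Sigma') (use real_mass_qlink in simp)
  moreover have "((\<lambda>Y. part_ratio n * real_mass n Y) has_sum part_ratio n * real_partition n) (C (Suc n))"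
    unfolding real_partition_def by (intro has_sum_cmult_right has_sum_infsum real_mass_summable)
  ultimately show ?thesis by (rule has_sum_unique)
qed

lemma coherent_system_real_mass:
  assumes \<mu>: "\<And>n X. X \<in> C (Suc n) \<Longrightarrow> \<mu> (Suc n) X = real_mass n X / real_partition n"
  shows "coherent_system q zm zp \<mu>"
  unfolding coherent_system_def
proof (intro conjI allI impI ballI)
  fix N :: nat assume "1 \<le> N"
  then obtain n where N: "N = Suc n" by (cases N) auto
  have "(real_mass n has_sum real_partition n) (C N)" unfolding real_partition_def N by (rule has_sum_infsum[OF real_mass_summable])
  from has_sum_cmult_left[OF this, of "1 / real_partition n"]
  have "((\<lambda>X. real_mass n X / real_partition n) has_sum 1) (C N)" using real_partition_pos[of n] by simp
  also have "?this \<longleftrightarrow> (\<mu> N has_sum 1) (C N)"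
    by (rule has_sum_cong) (simp add: \<mu> N)
  finally show "prob_mass_on (C N) (\<mu> N)"
    using \<mu> real_mass_pos real_partition_pos[of n] by (auto simp: prob_mass_on_def N intro!: divide_nonneg_nonneg less_imp_le)
next
  fix N Y assume "1 \<le> N" and Y: "Y \<in> C N"
  then obtain n where N: "N = Suc n" by (cases N) auto
  have "((\<lambda>X. real_mass (Suc n) X * qlink q zm zp (Suc n) X Y * (1 / real_partition (Suc n))) has_sum
      part_ratio n * real_mass n Y * (1 / real_partition (Suc n))) (C (Suc (Suc n)))"
    using Y by (intro has_sum_cmult_left real_mass_qlink) (simp add: N)
  also have "part_ratio n * real_mass n Y * (1 / real_partition (Suc n)) = real_mass n Y / real_partition n"
    using real_partition_pos[of "Suc n"] unfolding real_partition_Suc by (cases "part_ratio n = 0") auto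
  also have "\<dots> = \<mu> N Y" using \<mu> Y by (simp add: N)
  also have "((\<lambda>X. real_mass (Suc n) X * qlink q zm zp (Suc n) X Y * (1 / real_partition (Suc n))) has_sum \<mu> N Y) (C (Suc (Suc n))) \<longleftrightarrow>
      ((\<lambda>X. \<mu> (Suc N) X * qlink q zm zp N X Y) has_sum \<mu> N Y) (C (Suc N))"
    unfolding N by (rule has_sum_cong) (simp add: \<mu>)
  finally show "((\<lambda>X. \<mu> (Suc N) X * qlink q zm zp N X Y) has_sum \<mu> N Y) (C (Suc N))" .
qed

end

section \<open>Admissible parameters\<close>

lemma convergent_prod_qpoch:
  assumes "0 < q" "q < 1"
  shows "convergent_prod (\<lambda>m. 1 - a * of_real q ^ m :: complex)"
proof (rule abs_convergent_prod_imp_convergent_prod, rule summable_imp_abs_convergent_prod)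
  have "summable (\<lambda>m. norm a * q ^ m)"
    using assms by (intro summable_mult summable_geometric) simp
  then show "summable (\<lambda>m. norm (1 - a * of_real q ^ m - 1))"
    using assms by (simp add: norm_mult norm_power)
qed

lemma qpoch_inf_mult:
  assumes q: "0 < q" "q < 1" and c: "a + b = of_real c1" "a * b = of_real c2"
  shows "qpoch_inf (a * of_real x) q * qpoch_inf (b * of_real x) q = of_real (qprod q c1 c2 x)"
proof -
  have factor: "(1 - a * of_real x * of_real q ^ m) * (1 - b * of_real x * of_real q ^ m) =
      of_real (quad c1 c2 (x * q ^ m))" for m
  proof -
    have "(1 - a * of_real x * of_real q ^ m) * (1 - b * of_real x * of_real q ^ m) =
        1 - (a + b) * of_real (x * q ^ m) + (a * b) * of_real (x * q ^ m) ^ 2"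
      by (simp add: algebra_simps power2_eq_square)
    then show ?thesis unfolding c by (simp add: quad_def)
  qed
  have "qpoch_inf (a * of_real x) q * qpoch_inf (b * of_real x) q =
      (\<Prod>m. (1 - a * of_real x * of_real q ^ m) * (1 - b * of_real x * of_real q ^ m))"
    unfolding qpoch_inf_def by (intro prodinf_mult convergent_prod_qpoch q)
  also have "\<dots> = (\<Prod>m. complex_of_real (quad c1 c2 (x * q ^ m)))"
    unfolding factor ..
  also have "\<dots> = of_real (qprod q c1 c2 x)"
  proof -
    have "(\<lambda>m. quad c1 c2 (x * q ^ m)) has_prod qprod q c1 c2 x"
      unfolding qprod_def by (rule convergent_prod_has_prod[OF convergent_qprod[OF q]])
    then have "(\<lambda>m. complex_of_real (quad c1 c2 (x * q ^ m))) has_prod of_real (qprod q c1 c2 x)"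
      by (simp only: has_prod_of_real_iff)
    then show ?thesis by (rule has_prod_unique[symmetric])
  qed
  finally show ?thesis .
qed

context q_lattice
begin

text \<open>
  The lattice accumulates at 0 from both sides, so no gap contains 0.
\<close>

lemma lattice_gap_same_sign:
  assumes "u \<in> L" "v \<in> L" "u < v" "{u<..<v} \<inter> L = {}"
  shows "0 < u \<or> v < 0"
proof (rule ccontr)
  assume "\<not> (0 < u \<or> v < 0)"
  then have uv: "u < 0" "0 < v" using lattice_nonzero[of u] lattice_nonzero[of v] assms by auto
  \<comment> \<open>The point \<open>v * q\<close> would lie strictly between 0 and \<open>v\<close>.\<close>
  have "v * q < v" "0 < v * q" using uv q_pos q_less_1 by auto
  with uv have "v * q \<in> {u<..<v} \<inter> L" using lattice_mult[OF assms(2)] by auto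
  with assms(4) show False by simp
qed

text \<open>
  For a conjugate pair the quadratic is the squared modulus of \<open>1 - a x\<close>, which is nonzero as \<open>x\<close>
  is real and \<open>a\<close> is not. For a real pair it is \<open>a b (1/a - x) (1/b - x)\<close>; here \<open>a\<close> and \<open>b\<close> have the same sign, and
  every lattice point lies on the same side of both \<open>1/a\<close> and \<open>1/b\<close>.
\<close>

lemma admissible_pair_quad:
  assumes adm: "admissible_pair q zm zp a b" and nz: "a \<noteq> 0" "b \<noteq> 0"
  obtains c1 c2 where "a + b = of_real c1" "a * b = of_real c2" "0 < c2"
    "\<And>x. x \<in> L \<Longrightarrow> 0 < quad c1 c2 x"
  using adm unfolding admissible_pair_def
proof (elim disjE)
  assume ab: "a \<notin> \<real> \<and> b = cnj a"
  then have im: "Im a \<noteq> 0" by (auto simp: complex_is_Real_iff)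
  show ?thesis
  proof (rule that)
    show "a + b = of_real (2 * Re a)" using ab by (simp add: complex_add_cnj)
    show "a * b = of_real ((Re a)\<^sup>2 + (Im a)\<^sup>2)" using ab by (simp add: complex_mult_cnj)
    show "0 < (Re a)\<^sup>2 + (Im a)\<^sup>2" using im by (simp add: sum_power2_gt_zero_iff)
    fix x assume "x \<in> L"
    then have "Im a * x \<noteq> 0" using im lattice_nonzero by simp
    then have "0 < (1 - Re a * x)\<^sup>2 + (Im a * x)\<^sup>2" by (simp add: sum_power2_gt_zero_iff)
    then show "0 < quad (2 * Re a) ((Re a)\<^sup>2 + (Im a)\<^sup>2) x"
      by (simp add: quad_def power2_eq_square algebra_simps)
  qed
next
  assume real: "a \<in> \<real> \<and> b \<in> \<real> \<and> (\<exists>u\<in>L. \<exists>v\<in>L.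
         u < v \<and> {u<..<v} \<inter> L = {} \<and>
         Re (inverse a) \<in> {u<..<v} \<and> Re (inverse b) \<in> {u<..<v})"
  then obtain r s where rs: "a = of_real r" "b = of_real s" by (auto elim!: Reals_cases)
  with nz have rs0: "r \<noteq> 0" "s \<noteq> 0" by auto
  obtain u v where uv: "u \<in> L" "v \<in> L" "u < v" "{u<..<v} \<inter> L = {}"
    "u < inverse r" "inverse r < v" "u < inverse s" "inverse s < v"
    using real rs by (auto simp flip: of_real_inverse)
  have pos: "0 < r * s"
  proof -
    consider "0 < u" | "v < 0" using lattice_gap_same_sign[OF uv(1-4)] by blast
    then show ?thesis
    proof cases
      case 1
      then have "0 < inverse r" "0 < inverse s" using uv(5,7) by (blast intro: less_trans)+
      then show ?thesis by simp
    next
      case 2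
      then have "inverse r < 0" "inverse s < 0" using uv(6,8) by (blast intro: less_trans)+
      then show ?thesis by (simp add: mult_neg_neg)
    qed
  qed
  show ?thesis
  proof (rule that)
    show "a + b = of_real (r + s)" "a * b = of_real (r * s)" using rs by simp_all
    show "0 < r * s" by (rule pos)
    fix x assume "x \<in> L"
    then have "x \<notin> {u<..<v}" using uv(4) by blast
    then consider "x \<le> u" | "v \<le> x" by fastforce
    then have "0 < (inverse r - x) * (inverse s - x)"
      using uv by cases (auto intro: mult_pos_pos mult_neg_neg)
    then have "0 < (r * s) * ((inverse r - x) * (inverse s - x))" using pos by (rule mult_pos_pos[rotated])
    also have "\<dots> = quad (r + s) (r * s) x"
      using rs0 by (simp add: quad_def field_simps power2_eq_square)
    finally show "0 < quad (r + s) (r * s) x" .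
  qed
qed

end

context q_weights
begin

context
  fixes \<alpha> \<beta> \<gamma> \<delta> :: complex
  assumes sums: "\<alpha> + \<beta> = of_real a1" "\<gamma> + \<delta> = of_real b1"
    and prods: "\<alpha> * \<beta> = of_real a2" "\<gamma> * \<delta> = of_real b2"
begin

lemma weight_eq_w: "weight q (Suc n) \<alpha> \<beta> \<gamma> \<delta> x = of_real (w n x)"
proof -
  have "q powi (1 - int (Suc n)) = 1 / q ^ n" by (simp add: power_int_minus_divide)
  then have shift: "c * of_real (q powi (1 - int (Suc n))) * of_real x = c * of_real (x / q ^ n)" for c :: complex
    by simp
  show ?thesis
    unfolding weight_def shift w_def wratio_def
      qpoch_inf_mult[OF q_pos q_less_1 sums(1) prods(1)] qpoch_inf_mult[OF q_pos q_less_1 sums(2) prods(2)]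
    by simp
qed

lemma unnormalized_mass_eq_real_mass: "unnormalized_mass q \<alpha> \<beta> \<gamma> \<delta> (Suc n) X = of_real (real_mass n X)"
  by (simp add: unnormalized_mass_def weight_eq_w real_mass_def)

lemma partition_function_eq_real_partition: "partition_function q zm zp \<alpha> \<beta> \<gamma> \<delta> (Suc n) = of_real (real_partition n)"
  unfolding partition_function_def unnormalized_mass_eq_real_mass real_partition_def
  by (intro infsumI has_sum_of_real has_sum_infsum real_mass_summable)

lemma mass_eq: "mass q zm zp \<alpha> \<beta> \<gamma> \<delta> (Suc n) X = of_real (real_mass n X / real_partition n)"
  by (simp add: mass_def unnormalized_mass_eq_real_mass partition_function_eq_real_partition)

end

end

theorem theorem4p7:
  fixes q zm zp :: real and \<alpha> \<beta> \<gamma> \<delta> :: complex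
  assumes "0 < q" and "q < 1" and "zm < 0" and "zp > 0"
    and "admissible_nondegenerate q zm zp \<alpha> \<beta> \<gamma> \<delta>"
  shows "(\<forall>N\<ge>1. \<forall>X\<in>configs q zm zp N. mass q zm zp \<alpha> \<beta> \<gamma> \<delta> N X \<in> \<real>) \<and>
         coherent_system q zm zp (\<lambda>N X. Re (mass q zm zp \<alpha> \<beta> \<gamma> \<delta> N X))"
proof -
  interpret q_lattice q zm zp by unfold_locales (use assms in auto)
  note adm = assms(5)[unfolded admissible_nondegenerate_def]
  obtain a1 a2 where a: "\<alpha> + \<beta> = of_real a1" "\<alpha> * \<beta> = of_real a2" "0 < a2"
    "\<And>x. x \<in> L \<Longrightarrow> 0 < quad a1 a2 x"
    using admissible_pair_quad adm by metis
  obtain b1 b2 where b: "\<gamma> + \<delta> = of_real b1" "\<gamma> * \<delta> = of_real b2" "0 < b2"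
    "\<And>x. x \<in> L \<Longrightarrow> 0 < quad b1 b2 x"
    using admissible_pair_quad adm by metis
  have "a2 < b2 * q" using adm unfolding a(2) b(2) by simp
  then interpret q_weights q zm zp a1 a2 b1 b2
    by unfold_locales (use a b in auto)
  note mass = mass_eq[OF a(1) b(1) a(2) b(2)]
  show ?thesis
  proof (intro conjI allI impI ballI)
    fix N :: nat and X assume "1 \<le> N"
    then obtain n where "N = Suc n" by (cases N) auto
    then show "mass q zm zp \<alpha> \<beta> \<gamma> \<delta> N X \<in> \<real>" by (simp only: mass Reals_of_real)
  next
    show "coherent_system q zm zp (\<lambda>N X. Re (mass q zm zp \<alpha> \<beta> \<gamma> \<delta> N X))"
      by (rule coherent_system_real_mass) (simp only: mass Re_complex_of_real)
  qed
qed

end
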